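(* There exists a universal constant $C>0$ such that for every $n\ge1$ and every $A\in M_2(\mathbb{C})^{\otimes n}$ with operator norm $\|A\|\le 1$, $$\operatorname{Var}(A)\le C\sum_{j=1}^n\frac{\|d_jA\|_1\,(1+\|d_jA\|_1)}{[1+\log^+(1/\|d_jA\|_1)]^{1/2}} .$$
   Context: $M_2(\mathbb{C})^{\otimes n}\cong M_{2^n}(\mathbb{C})$ is the algebra of operators on $n$ qubits, with operator norm $\|\cdot\|$, trace $\operatorname{tr}$ and identity $\mathbf 1$. Normalized Schatten norm: $\|A\|_p=(2^{-n}\operatorname{tr}|A|^p)^{1/p}$. $\operatorname{Var}(A)=\|A-2^{-n}\operatorname{tr}(A)\mathbf 1\|_2^2$. For $1\le j\le n$, $d_j=\mathbb I^{\otimes(j-1)}\otimes(\mathbb I-\tfrac12\operatorname{tr}(\cdot)\mathbf 1)\otimes\mathbb I^{\otimes(n-j)}$, where $\mathbb I$ is the identity map on $M_2(\mathbb{C})$. $\log^+$ is the positive part of the natural logarithm; a summand with $\|d_jA\|_1=0$ is interpreted as $0$. *)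

theory Defs
  imports Complex_Main "Jordan_Normal_Form.Schur_Decomposition"
begin

definition mat_trace :: "complex mat \<Rightarrow> complex" where
  "mat_trace A = (\<Sum>i<dim_row A. A $$ (i, i))"

definition euclid_norm :: "complex vec \<Rightarrow> real" where
  "euclid_norm v = sqrt (Re (v \<bullet>c v))"

definition op_norm :: "complex mat \<Rightarrow> real" where
  "op_norm A =
     (SUP v\<in>{v \<in> carrier_vec (dim_col A). euclid_norm v \<le> 1}. euclid_norm (A *\<^sub>v v))"

text \<open>The order on complex numbers is that of \<open>HOL-Library.Complex_Order\<close>: \<open>0 \<le> z\<close> says
  that \<open>z\<close> is real and nonnegative. Over the complex numbers this makes \<open>P\<close> Hermitian.\<close>

definition pos_semidef :: "complex mat \<Rightarrow> bool" where
  "pos_semidef P \<longleftrightarrow> square_mat P \<and> (\<forall>v\<in>carrier_vec (dim_row P). 0 \<le> (P *\<^sub>v v) \<bullet>c v)"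

text \<open>The modulus \<open>|A|\<close>: the positive semidefinite square root of \<open>A\<^sup>* A\<close>.\<close>

definition mat_abs :: "complex mat \<Rightarrow> complex mat" where
  "mat_abs A = (THE P. P \<in> carrier_mat (dim_col A) (dim_col A) \<and> pos_semidef P
                       \<and> P * P = mat_adjoint A * A)"

text \<open>Normalized Schatten norm of an operator on \<open>n\<close> qubits, for integer exponents \<open>p \<ge> 1\<close>.\<close>

definition schatten_norm :: "nat \<Rightarrow> nat \<Rightarrow> complex mat \<Rightarrow> real" where
  "schatten_norm n p A = root p (Re (mat_trace (mat_abs A ^\<^sub>m p)) / 2 ^ n)"

definition qvar :: "nat \<Rightarrow> complex mat \<Rightarrow> real" where
  "qvar n A = (schatten_norm n 2 (A - (mat_trace A / 2 ^ n) \<cdot>\<^sub>m 1\<^sub>m (2 ^ n)))\<^sup>2"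

definition kron :: "complex mat \<Rightarrow> complex mat \<Rightarrow> complex mat" where
  "kron A B = mat (dim_row A * dim_row B) (dim_col A * dim_col B)
     (\<lambda>(i, j). A $$ (i div dim_row B, j div dim_col B) * B $$ (i mod dim_row B, j mod dim_col B))"

definition kron_list :: "complex mat list \<Rightarrow> complex mat" where
  "kron_list As = foldr kron As (1\<^sub>m 1)"

definition mat_unit :: "nat \<Rightarrow> nat \<Rightarrow> complex mat" where
  "mat_unit a b = mat 2 2 (\<lambda>(i, j). if i = a \<and> j = b then 1 else 0)"

text \<open>The \<open>n\<close> binary digits of \<open>k < 2 ^ n\<close>, position \<open>i < n\<close> counted from the most significant
  one. With this order, matching \<^const>\<open>kron\<close>, the matrix unit of size \<open>2 ^ n\<close> at \<open>(a, b)\<close> is the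
  tensor product over \<open>i\<close> of \<open>mat_unit (qdigit n i a) (qdigit n i b)\<close>.\<close>

definition qdigit :: "nat \<Rightarrow> nat \<Rightarrow> nat \<Rightarrow> nat" where
  "qdigit n i k = k div 2 ^ (n - 1 - i) mod 2"

text \<open>The map \<open>T\<^sub>1 \<otimes> \<dots> \<otimes> T\<^sub>n\<close>, for linear maps \<open>T\<^sub>i\<close> on 2-by-2 matrices: expand \<open>A\<close> in
  matrix units, apply \<open>T\<^sub>i\<close> to the \<open>i\<close>-th tensor factor of each, and extend linearly.\<close>

definition tensor_map :: "(complex mat \<Rightarrow> complex mat) list \<Rightarrow> complex mat \<Rightarrow> complex mat" where
  "tensor_map Ts A = (let n = length Ts in
     mat (2 ^ n) (2 ^ n) (\<lambda>(r, s). \<Sum>a<2 ^ n. \<Sum>b<2 ^ n. A $$ (a, b) *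
       kron_list (map (\<lambda>i. (Ts ! i) (mat_unit (qdigit n i a) (qdigit n i b))) [0..<n]) $$ (r, s)))"

definition qdiff :: "nat \<Rightarrow> nat \<Rightarrow> complex mat \<Rightarrow> complex mat" where
  "qdiff n j = tensor_map
     (replicate (j - 1) (\<lambda>X. X) @ [\<lambda>X. X - (mat_trace X / 2) \<cdot>\<^sub>m 1\<^sub>m 2] @ replicate (n - j) (\<lambda>X. X))"

definition log_plus :: "real \<Rightarrow> real" where
  "log_plus x = max 0 (ln x)"

end

theory Submission
  imports Defs "HOL-Analysis.L2_Norm" "Jordan_Normal_Form.Spectral_Radius"
begin

text \<open>Write \<open>A\<close> in the basis of Pauli strings \<open>S\<close>, with coefficients \<open>c S\<close> and weights \<open>|S|\<close> (the number
  of non-identity letters). Since \<open>d\<^sub>j\<close> keeps the strings with a non-identity letter at \<open>j\<close>, the variance is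
  the sum over \<open>j\<close> of \<open>W\<^sub>j = \<Sum>\<^sub>S |c S|\<^sup>2 / |S|\<close>, over the strings of \<open>g = d\<^sub>j A\<close>. Put \<open>t = \<parallel>g\<parallel>\<^sub>1\<close>.
  Pairing \<open>g\<close> with the contraction \<open>A\<close> gives \<open>\<parallel>g\<parallel>\<^sub>2\<^sup>2 \<le> t\<close>. A Bonami-type inequality
  \<open>\<parallel>T g\<parallel>\<^sub>4 \<le> \<parallel>g\<parallel>\<^sub>2\<close>, where \<open>T\<close> multiplies the coefficient at \<open>S\<close> by \<open>3\<^sup>-\<^sup>|\<^sup>S\<^sup>|\<close>, is proved by induction on
  the number of qubits. Dualised and interpolated between \<open>\<parallel>g\<parallel>\<^sub>1\<close> and \<open>\<parallel>g\<parallel>\<^sub>2\<close>, it gives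
  \<open>\<parallel>T g\<parallel>\<^sub>2\<^sup>2 \<le> \<parallel>g\<parallel>\<^sub>1 \<parallel>g\<parallel>\<^sub>2 \<le> t \<surd>t\<close>. Splitting at weight \<open>m\<close> yields
  \<open>W\<^sub>j \<le> 9\<^sup>m t \<surd>t + t / m\<close>, and \<open>m \<approx> ln (1/t) / 12\<close> gives \<open>W\<^sub>j \<le> 49 t / (1 + ln (1/t))\<close> for \<open>t < 1\<close>.\<close>

section \<open>Hilbert--Schmidt norms and Pauli blocks\<close>

text \<open>Matrices are plain index functions with the dimension as a parameter, so that quadrants
  and slices need no carrier conditions; only entries below \<open>N\<close> matter.
  \<open>gram\<close> is the product \<open>X\<^sup>*Y\<close>.\<close>

definition gram :: "nat \<Rightarrow> (nat \<Rightarrow> nat \<Rightarrow> complex) \<Rightarrow> (nat \<Rightarrow> nat \<Rightarrow> complex) \<Rightarrow> nat \<Rightarrow> nat \<Rightarrow> complex" where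
  "gram N X Y i j = (\<Sum>k<N. cnj (X k i) * Y k j)"

definition hs_inner :: "nat \<Rightarrow> (nat \<Rightarrow> nat \<Rightarrow> complex) \<Rightarrow> (nat \<Rightarrow> nat \<Rightarrow> complex) \<Rightarrow> complex" where
  "hs_inner N X Y = (\<Sum>i<N. \<Sum>j<N. cnj (X i j) * Y i j)"

text \<open>The norm is not normalized; powers of \<open>2 ^ n\<close> are carried explicitly until
  the Schatten norms appear. Through \<open>L2_set\<close> it inherits the triangle and
  Cauchy-Schwarz inequalities.\<close>

definition hs_norm :: "nat \<Rightarrow> (nat \<Rightarrow> nat \<Rightarrow> complex) \<Rightarrow> real" where
  "hs_norm N X = L2_set (\<lambda>(i, j). cmod (X i j)) ({..<N} \<times> {..<N})"

lemma hs_norm_nonneg [simp]: "0 \<le> hs_norm N X"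
  by (simp add: hs_norm_def)

lemma hs_norm_power2: "(hs_norm N X)\<^sup>2 = (\<Sum>i<N. \<Sum>j<N. (cmod (X i j))\<^sup>2)"
  unfolding hs_norm_def L2_set_def
  by (simp add: sum_nonneg case_prod_beta sum.cartesian_product)

lemma hs_inner_self: "hs_inner N X X = of_real ((hs_norm N X)\<^sup>2)"
  unfolding hs_norm_power2 hs_inner_def
  by (simp add: complex_norm_square mult.commute del: of_real_power)

lemma hs_norm_cong:
  "(\<And>i j. i < N \<Longrightarrow> j < N \<Longrightarrow> X i j = Y i j) \<Longrightarrow> hs_norm N X = hs_norm N Y"
  unfolding hs_norm_def by (rule L2_set_cong) auto

lemma hs_norm_add: "hs_norm N (\<lambda>i j. X i j + Y i j) \<le> hs_norm N X + hs_norm N Y"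
proof -
  have "hs_norm N (\<lambda>i j. X i j + Y i j)
      \<le> L2_set (\<lambda>p. (\<lambda>(i, j). cmod (X i j)) p + (\<lambda>(i, j). cmod (Y i j)) p) ({..<N} \<times> {..<N})"
    unfolding hs_norm_def by (rule L2_set_mono) (auto intro: norm_triangle_ineq)
  also have "\<dots> \<le> hs_norm N X + hs_norm N Y"
    unfolding hs_norm_def by (rule L2_set_triangle_ineq)
  finally show ?thesis .
qed

lemma hs_norm_unit_mult: "cmod u = 1 \<Longrightarrow> hs_norm N (\<lambda>i j. u * X i j) = hs_norm N X"
  unfolding hs_norm_def by (simp add: norm_mult)

lemma hs_inner_Cauchy_Schwarz: "cmod (hs_inner N X Y) \<le> hs_norm N X * hs_norm N Y"
proof -
  have "cmod (hs_inner N X Y) = cmod (\<Sum>p\<in>{..<N} \<times> {..<N}. case p of (i, j) \<Rightarrow> cnj (X i j) * Y i j)"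
    by (simp add: hs_inner_def sum.cartesian_product)
  also have "\<dots> \<le> (\<Sum>p\<in>{..<N} \<times> {..<N}. \<bar>(\<lambda>(i, j). cmod (X i j)) p\<bar> * \<bar>(\<lambda>(i, j). cmod (Y i j)) p\<bar>)"
    by (rule sum_norm_le) (auto simp: norm_mult)
  also have "\<dots> \<le> hs_norm N X * hs_norm N Y"
    unfolding hs_norm_def by (rule L2_set_mult_ineq)
  finally show ?thesis .
qed

lemma sum_pair_swap:
  "(\<Sum>i\<in>A. \<Sum>j\<in>B. \<Sum>k\<in>C. \<Sum>l\<in>D. f i j k l) = (\<Sum>k\<in>C. \<Sum>l\<in>D. \<Sum>i\<in>A. \<Sum>j\<in>B. f i j k l)"
proof -
  have "(\<Sum>i\<in>A. \<Sum>j\<in>B. \<Sum>k\<in>C. \<Sum>l\<in>D. f i j k l) = (\<Sum>i\<in>A. \<Sum>k\<in>C. \<Sum>j\<in>B. \<Sum>l\<in>D. f i j k l)"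
    by (intro sum.cong refl sum.swap)
  also have "\<dots> = (\<Sum>k\<in>C. \<Sum>i\<in>A. \<Sum>j\<in>B. \<Sum>l\<in>D. f i j k l)"
    by (rule sum.swap)
  also have "\<dots> = (\<Sum>k\<in>C. \<Sum>i\<in>A. \<Sum>l\<in>D. \<Sum>j\<in>B. f i j k l)"
    by (intro sum.cong refl sum.swap)
  also have "\<dots> = (\<Sum>k\<in>C. \<Sum>l\<in>D. \<Sum>i\<in>A. \<Sum>j\<in>B. f i j k l)"
    by (intro sum.cong refl sum.swap)
  finally show ?thesis .
qed

text \<open>Cyclicity of the trace: \<open>Y\<^sup>*X X\<^sup>*Y\<close> and
  \<open>X X\<^sup>*Y Y\<^sup>*\<close> have the same trace. Feeding conjugate transposes to
  \<open>gram\<close> produces \<open>X X\<^sup>*\<close> and \<open>Y Y\<^sup>*\<close>.\<close>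

lemma hs_norm_gram_eq_inner:
  "of_real ((hs_norm N (gram N X Y))\<^sup>2)
     = hs_inner N (gram N (\<lambda>i j. cnj (X j i)) (\<lambda>i j. cnj (X j i))) (gram N (\<lambda>i j. cnj (Y j i)) (\<lambda>i j. cnj (Y j i)))"
proof -
  have "of_real ((hs_norm N (gram N X Y))\<^sup>2)
      = (\<Sum>i<N. \<Sum>j<N. \<Sum>k<N. \<Sum>l<N. X k i * cnj (Y k j) * (cnj (X l i) * Y l j))"
    unfolding hs_inner_self[symmetric] hs_inner_def gram_def
    by (simp add: sum_product)
  also have "\<dots> = (\<Sum>l<N. \<Sum>k<N. \<Sum>i<N. \<Sum>j<N. X k i * cnj (Y k j) * (cnj (X l i) * Y l j))"
    by (rule trans[OF sum_pair_swap sum.swap])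
  also have "\<dots> = hs_inner N (gram N (\<lambda>i j. cnj (X j i)) (\<lambda>i j. cnj (X j i))) (gram N (\<lambda>i j. cnj (Y j i)) (\<lambda>i j. cnj (Y j i)))"
    unfolding hs_inner_def gram_def
    by (simp add: sum_product mult_ac)
  finally show ?thesis .
qed

lemma hs_norm_gram_adjoint: "hs_norm N (gram N (\<lambda>i j. cnj (X j i)) (\<lambda>i j. cnj (X j i))) = hs_norm N (gram N X X)"
proof -
  have "complex_of_real ((hs_norm N (gram N X X))\<^sup>2)
      = of_real ((hs_norm N (gram N (\<lambda>i j. cnj (X j i)) (\<lambda>i j. cnj (X j i))))\<^sup>2)"
    by (subst hs_norm_gram_eq_inner) (rule hs_inner_self)
  then have "(hs_norm N (gram N X X))\<^sup>2 = (hs_norm N (gram N (\<lambda>i j. cnj (X j i)) (\<lambda>i j. cnj (X j i))))\<^sup>2"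
    using of_real_eq_iff by blast
  then show ?thesis
    by simp
qed

text \<open>Hoelder's inequality \<open>\<parallel>X\<^sup>*Y\<parallel>\<^sub>2 \<le> \<parallel>X\<parallel>\<^sub>4 \<parallel>Y\<parallel>\<^sub>4\<close>, with \<open>\<parallel>X\<parallel>\<^sub>4\<^sup>2 = \<parallel>X\<^sup>*X\<parallel>\<^sub>2\<close>.\<close>

lemma hs_norm_gram_le: "(hs_norm N (gram N X Y))\<^sup>2 \<le> hs_norm N (gram N X X) * hs_norm N (gram N Y Y)"
proof -
  have "(hs_norm N (gram N X Y))\<^sup>2 = cmod (of_real ((hs_norm N (gram N X Y))\<^sup>2))"
    by (simp del: of_real_power)
  also have "\<dots> \<le> hs_norm N (gram N X X) * hs_norm N (gram N Y Y)"
    unfolding hs_norm_gram_eq_inner using hs_inner_Cauchy_Schwarz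
    by (metis hs_norm_gram_adjoint)
  finally show ?thesis .
qed

section \<open>Block matrices in the Pauli basis of the first qubit\<close>

lemma sum_lessThan_double: "(\<Sum>i<2 * N. f i) = (\<Sum>i<N. f i + f (i + N))" for N :: nat
proof -
  have "(\<Sum>i<2 * N. f i) = (\<Sum>i<N. f i) + (\<Sum>i=N..<N + N. f i)"
    using sum.atLeastLessThan_concat[of 0 N "N + N" f] by (simp add: lessThan_atLeast0 mult_2)
  also have "(\<Sum>i=N..<N + N. f i) = (\<Sum>i<N. f (i + N))"
    using sum.shift_bounds_nat_ivl[of f 0 N N] by (simp add: lessThan_atLeast0)
  finally show ?thesis
    by (simp add: sum.distrib)
qed

text \<open>The block matrix of \<open>\<Sum>k. \<sigma>\<^sub>k \<otimes> M k\<close>, where the letters 0, 1, 2, 3 stand for the Pauli matrices I, X, Y, Z.\<close>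

definition pauli_block :: "nat \<Rightarrow> (nat \<Rightarrow> nat \<Rightarrow> nat \<Rightarrow> complex) \<Rightarrow> nat \<Rightarrow> nat \<Rightarrow> complex" where
  "pauli_block N M i j =
    (if i < N
     then if j < N then M 0 i j + M 3 i j else M 1 i (j - N) - \<i> * M 2 i (j - N)
     else if j < N then M 1 (i - N) j + \<i> * M 2 (i - N) j else M 0 (i - N) (j - N) - M 3 (i - N) (j - N))"

lemma lessThan_4: "{..<4::nat} = {0, 1, 2, 3}"
  by auto

lemma sum_lessThan_4: "(\<Sum>i<4. f i) = f 0 + f 1 + f 2 + f 3" for f :: "nat \<Rightarrow> 'a::comm_monoid_add"
  by (simp add: lessThan_4 add_ac)

text \<open>The Pauli matrices are orthogonal with squared Hilbert-Schmidt norm 2, so the cross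
  terms of the four quadrants cancel.\<close>

lemma hs_inner_pauli_block:
  "hs_inner (2 * N) (pauli_block N M) (pauli_block N M') = 2 * (\<Sum>k<4. hs_inner N (M k) (M' k))"
proof -
  have "hs_inner (2 * N) (pauli_block N M) (pauli_block N M') =
    (\<Sum>i<N. \<Sum>j<N.
       cnj (M 0 i j + M 3 i j) * (M' 0 i j + M' 3 i j) +
       cnj (M 1 i j - \<i> * M 2 i j) * (M' 1 i j - \<i> * M' 2 i j) +
       (cnj (M 1 i j + \<i> * M 2 i j) * (M' 1 i j + \<i> * M' 2 i j) +
       cnj (M 0 i j - M 3 i j) * (M' 0 i j - M' 3 i j)))"
    unfolding hs_inner_def sum_lessThan_double
    by (simp add: pauli_block_def sum.distrib del: complex_cnj_add complex_cnj_diff)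
  also have "\<dots> = 2 * (\<Sum>k<4. hs_inner N (M k) (M' k))"
    unfolding hs_inner_def sum_lessThan_4
    by (simp only: sum.distrib[symmetric] sum_distrib_left)
      (intro sum.cong refl, simp add: algebra_simps)
  finally show ?thesis .
qed

lemma hs_norm_pauli_block:
  "(hs_norm (2 * N) (pauli_block N M))\<^sup>2 = 2 * (\<Sum>k<4. (hs_norm N (M k))\<^sup>2)"
proof -
  have "complex_of_real ((hs_norm (2 * N) (pauli_block N M))\<^sup>2) = of_real (2 * (\<Sum>k<4. (hs_norm N (M k))\<^sup>2))"
    unfolding hs_inner_self[symmetric] hs_inner_pauli_block by (simp add: hs_inner_self)
  then show ?thesis
    using of_real_eq_iff by blast
qed

text \<open>The Pauli coefficients of \<open>B\<^sup>*B\<close> for \<open>B = \<Sum>k. \<sigma>\<^sub>k \<otimes> M k\<close>.\<close>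

definition pauli_gram :: "nat \<Rightarrow> (nat \<Rightarrow> nat \<Rightarrow> nat \<Rightarrow> complex) \<Rightarrow> nat \<Rightarrow> nat \<Rightarrow> nat \<Rightarrow> complex" where
  "pauli_gram N M k =
    (let G = (\<lambda>a b. gram N (M a) (M b)) in
     if k = 0 then (\<lambda>i j. G 0 0 i j + G 1 1 i j + G 2 2 i j + G 3 3 i j)
     else if k = 1 then (\<lambda>i j. G 0 1 i j + G 1 0 i j + (\<i> * G 2 3 i j + (- \<i>) * G 3 2 i j))
     else if k = 2 then (\<lambda>i j. G 0 2 i j + G 2 0 i j + (\<i> * G 3 1 i j + (- \<i>) * G 1 3 i j))
     else (\<lambda>i j. G 0 3 i j + G 3 0 i j + (\<i> * G 1 2 i j + (- \<i>) * G 2 1 i j)))"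

text \<open>Each coefficient as a single sum over the row index \<open>k\<close>, so that the block
  identity below can be checked term by term.\<close>

lemma pauli_gram_sum:
  "pauli_gram N M 0 i j = (\<Sum>k<N. cnj (M 0 k i) * M 0 k j + cnj (M 1 k i) * M 1 k j
     + cnj (M 2 k i) * M 2 k j + cnj (M 3 k i) * M 3 k j)"
  "pauli_gram N M 1 i j = (\<Sum>k<N. cnj (M 0 k i) * M 1 k j + cnj (M 1 k i) * M 0 k j
     + \<i> * (cnj (M 2 k i) * M 3 k j) - \<i> * (cnj (M 3 k i) * M 2 k j))"
  "pauli_gram N M 2 i j = (\<Sum>k<N. cnj (M 0 k i) * M 2 k j + cnj (M 2 k i) * M 0 k j
     + \<i> * (cnj (M 3 k i) * M 1 k j) - \<i> * (cnj (M 1 k i) * M 3 k j))"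
  "pauli_gram N M 3 i j = (\<Sum>k<N. cnj (M 0 k i) * M 3 k j + cnj (M 3 k i) * M 0 k j
     + \<i> * (cnj (M 1 k i) * M 2 k j) - \<i> * (cnj (M 2 k i) * M 1 k j))"
  by (simp_all add: pauli_gram_def gram_def sum.distrib sum_distrib_left sum_subtractf)

text \<open>This is the multiplication table of the Pauli matrices: squares are the identity, and
  the product of two different non-identity letters is \<open>\<i>\<close> or \<open>- \<i>\<close>
  times the third. The four cases are the quadrants.\<close>

lemma gram_pauli_block:
  assumes "i < 2 * N" "j < 2 * N"
  shows "gram (2 * N) (pauli_block N M) (pauli_block N M) i j = pauli_block N (pauli_gram N M) i j"
proof -
  have "\<And>k. k < N \<Longrightarrow> pauli_block N M k l =
        (if l < N then M 0 k l + M 3 k l else M 1 k (l - N) - \<i> * M 2 k (l - N))"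
       "\<And>k. pauli_block N M (k + N) l =
        (if l < N then M 1 k l + \<i> * M 2 k l else M 0 k (l - N) - M 3 k (l - N))" for l
    by (simp_all add: pauli_block_def)
  note block = this
  have *: "gram (2 * N) (pauli_block N M) (pauli_block N M) i j =
     (\<Sum>k<N. cnj (if i < N then M 0 k i + M 3 k i else M 1 k (i - N) - \<i> * M 2 k (i - N)) *
             (if j < N then M 0 k j + M 3 k j else M 1 k (j - N) - \<i> * M 2 k (j - N)) +
            cnj (if i < N then M 1 k i + \<i> * M 2 k i else M 0 k (i - N) - M 3 k (i - N)) *
             (if j < N then M 1 k j + \<i> * M 2 k j else M 0 k (j - N) - M 3 k (j - N)))"
    unfolding gram_def sum_lessThan_double by (intro sum.cong refl) (simp only: block lessThan_iff)
  note sums = sum.distrib[symmetric] sum_subtractf[symmetric] sum_distrib_left if_True if_False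
  show ?thesis
  proof (cases "i < N"; cases "j < N")
    assume "i < N" "j < N"
    then show ?thesis
      unfolding * pauli_block_def[of N "pauli_gram N M"] pauli_gram_sum
      by (simp only: sums) (intro sum.cong refl, simp add: algebra_simps)
  next
    assume "i < N" "\<not> j < N"
    then show ?thesis
      unfolding * pauli_block_def[of N "pauli_gram N M"] pauli_gram_sum
      by (simp only: sums) (intro sum.cong refl, simp add: algebra_simps)
  next
    assume "\<not> i < N" "j < N"
    then show ?thesis
      unfolding * pauli_block_def[of N "pauli_gram N M"] pauli_gram_sum
      by (simp only: sums) (intro sum.cong refl, simp add: algebra_simps)
  next
    assume "\<not> i < N" "\<not> j < N"
    then show ?thesis
      unfolding * pauli_block_def[of N "pauli_gram N M"] pauli_gram_sum
      by (simp only: sums) (intro sum.cong refl, simp add: algebra_simps)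
  qed
qed

section \<open>Pauli expansions and hypercontractivity\<close>

text \<open>The first letter acts on the most significant binary digit of the index, the same order
  as in \<open>kron\<close>.\<close>

fun pauli_sum :: "nat \<Rightarrow> (nat list \<Rightarrow> complex) \<Rightarrow> nat \<Rightarrow> nat \<Rightarrow> complex" where
  "pauli_sum 0 c = (\<lambda>i j. c [])"
| "pauli_sum (Suc n) c = pauli_block (2 ^ n) (\<lambda>k. pauli_sum n (\<lambda>S. c (k # S)))"

definition pauli_strings :: "nat \<Rightarrow> nat list set" where
  "pauli_strings n = {S. set S \<subseteq> {..<4} \<and> length S = n}"

definition weight :: "nat list \<Rightarrow> nat" where
  "weight S = length (filter (\<lambda>k. k \<noteq> 0) S)"

lemma finite_pauli_strings [simp]: "finite (pauli_strings n)"
  unfolding pauli_strings_def by (rule finite_lists_length_eq) simp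

lemma pauli_strings_0: "pauli_strings 0 = {[]}"
  by (auto simp: pauli_strings_def)

lemma sum_pauli_strings_Suc:
  "sum f (pauli_strings (Suc n)) = (\<Sum>k<4. \<Sum>S\<in>pauli_strings n. f (k # S))"
proof -
  have "sum f (pauli_strings (Suc n)) = (\<Sum>(S, k)\<in>pauli_strings n \<times> {..<4}. f (k # S))"
    unfolding pauli_strings_def lists_length_Suc_eq
    by (subst sum.reindex) (auto simp: inj_on_def case_prod_beta)
  also have "\<dots> = (\<Sum>S\<in>pauli_strings n. \<Sum>k<4. f (k # S))"
    by (simp add: sum.cartesian_product)
  finally show ?thesis
    by (simp only: sum.swap[of _ "{..<4}"])
qed

text \<open>Parseval: by the one-qubit orthogonality, different strings are orthogonal and each has
  squared norm \<open>2 ^ n\<close>.\<close>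

lemma hs_inner_pauli_sum:
  "hs_inner (2 ^ n) (pauli_sum n c) (pauli_sum n d) = 2 ^ n * (\<Sum>S\<in>pauli_strings n. cnj (c S) * d S)"
  by (induction n arbitrary: c d)
    (simp_all add: hs_inner_pauli_block sum_pauli_strings_Suc sum_distrib_left mult.assoc,
     simp_all add: hs_inner_def pauli_strings_0)

lemma hs_norm_pauli_sum:
  "(hs_norm (2 ^ n) (pauli_sum n c))\<^sup>2 = 2 ^ n * (\<Sum>S\<in>pauli_strings n. (cmod (c S))\<^sup>2)"
proof -
  have "complex_of_real ((hs_norm (2 ^ n) (pauli_sum n c))\<^sup>2)
      = of_real (2 ^ n * (\<Sum>S\<in>pauli_strings n. (cmod (c S))\<^sup>2))"
    unfolding hs_inner_self[symmetric] hs_inner_pauli_sum of_real_mult of_real_sum complex_norm_square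
    by (simp add: mult.commute)
  then show ?thesis
    using of_real_eq_iff by blast
qed

lemma pauli_sum_surj: "\<exists>c. \<forall>i<2 ^ n. \<forall>j<2 ^ n. pauli_sum n c i j = X i j"
proof (induction n arbitrary: X)
  case 0
  show ?case
    by (intro exI[of _ "\<lambda>_. X 0 0"]) simp
next
  case (Suc n)
  define N :: nat where "N = 2 ^ n"
  \<comment> \<open>Inverts \<open>pauli_block\<close>: half sums and half differences of opposite
    quadrants, the factor \<open>\<i>\<close> undoing the \<open>- \<i>\<close> at letter 2.\<close>
  define Y where "Y k = (\<lambda>i j.
      if k = 0 then (X i j + X (i + N) (j + N)) / 2
      else if k = 1 then (X i (j + N) + X (i + N) j) / 2
      else if k = 2 then \<i> * (X i (j + N) - X (i + N) j) / 2
      else (X i j - X (i + N) (j + N)) / 2)" for k :: nat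
  have "\<forall>k. \<exists>c. \<forall>i<N. \<forall>j<N. pauli_sum n c i j = Y k i j"
    unfolding N_def using Suc.IH by blast
  then obtain c where c: "\<And>k i j. i < N \<Longrightarrow> j < N \<Longrightarrow> pauli_sum n (c k) i j = Y k i j"
    by metis
  have "pauli_sum (Suc n) (\<lambda>S. c (hd S) (tl S)) i j = X i j" if "i < 2 * N" "j < 2 * N" for i j
    using that by (auto simp: N_def[symmetric] pauli_block_def c Y_def field_simps)
  then show ?case
    by (intro exI[of _ "\<lambda>S. c (hd S) (tl S)"]) (simp add: N_def)
qed

lemma pauli_sum_diff: "pauli_sum n (\<lambda>S. c S - d S) i j = pauli_sum n c i j - pauli_sum n d i j"
proof (induction n arbitrary: c d i j)
  case (Suc n)
  show ?case
    unfolding pauli_sum.simps pauli_block_def Suc.IH by (simp add: algebra_simps)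
qed simp

lemma pauli_sum_zero: "pauli_sum n (\<lambda>S. 0) i j = 0"
  by (induction n arbitrary: i j) (simp_all add: pauli_block_def)

lemma pauli_sum_scalar:
  "i < 2 ^ n \<Longrightarrow> j < 2 ^ n \<Longrightarrow>
    pauli_sum n (\<lambda>S. if S = replicate n 0 then u else 0) i j = (if i = j then u else 0)"
  by (induction n arbitrary: i j) (auto simp: pauli_block_def pauli_sum_zero)

text \<open>Here \<open>s k\<close> bounds the 4-norm of the slice \<open>M k\<close>, so Hoelder's
  inequality bounds every product in \<open>pauli_gram\<close> by \<open>s a * s b\<close>. The
  factors \<open>\<i>\<close> and \<open>- \<i>\<close> do not change norms, and the triangle
  inequality adds the four products of each letter.\<close>

lemma hs_norm_pauli_gram:
  assumes h: "\<And>k. k < 4 \<Longrightarrow> hs_norm N (gram N (M k) (M k)) \<le> (s k)\<^sup>2"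
    and s: "\<And>k. 0 \<le> s k"
  shows "hs_norm N (pauli_gram N M 0) \<le> (s 0)\<^sup>2 + (s 1)\<^sup>2 + (s 2)\<^sup>2 + (s 3)\<^sup>2"
    and "hs_norm N (pauli_gram N M 1) \<le> 2 * (s 0 * s 1 + s 2 * s 3)"
    and "hs_norm N (pauli_gram N M 2) \<le> 2 * (s 0 * s 2 + s 3 * s 1)"
    and "hs_norm N (pauli_gram N M 3) \<le> 2 * (s 0 * s 3 + s 1 * s 2)"
proof -
  have G: "hs_norm N (gram N (M a) (M b)) \<le> s a * s b" if "a < 4" "b < 4" for a b
  proof -
    have "(hs_norm N (gram N (M a) (M b)))\<^sup>2 \<le> (s a * s b)\<^sup>2"
      using hs_norm_gram_le[of N "M a" "M b"] mult_mono[OF h[OF that(1)] h[OF that(2)]]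
      by (simp add: power_mult_distrib)
    then show ?thesis
      using s by (simp add: power2_le_iff_abs_le)
  qed
  have add4: "hs_norm N (\<lambda>i j. A i j + B i j + (\<i> * C i j + (- \<i>) * D i j))
      \<le> hs_norm N A + hs_norm N B + (hs_norm N C + hs_norm N D)" for A B C D
    using hs_norm_unit_mult[of "\<i>" N C] hs_norm_unit_mult[of "- \<i>" N D]
    by (intro order.trans[OF hs_norm_add] add_mono order.refl) simp_all
  show "hs_norm N (pauli_gram N M 0) \<le> (s 0)\<^sup>2 + (s 1)\<^sup>2 + (s 2)\<^sup>2 + (s 3)\<^sup>2"
    unfolding pauli_gram_def Let_def
    using h[of 0] h[of 1] h[of 2] h[of 3]
    by (simp, intro order.trans[OF hs_norm_add] add_mono) auto
  show "hs_norm N (pauli_gram N M 1) \<le> 2 * (s 0 * s 1 + s 2 * s 3)"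
    using add4[of "gram N (M 0) (M 1)" "gram N (M 1) (M 0)" "gram N (M 2) (M 3)" "gram N (M 3) (M 2)"]
      G[of 0 1] G[of 1 0] G[of 2 3] G[of 3 2]
    by (simp add: pauli_gram_def Let_def mult.commute)
  show "hs_norm N (pauli_gram N M 2) \<le> 2 * (s 0 * s 2 + s 3 * s 1)"
    using add4[of "gram N (M 0) (M 2)" "gram N (M 2) (M 0)" "gram N (M 3) (M 1)" "gram N (M 1) (M 3)"]
      G[of 0 2] G[of 2 0] G[of 3 1] G[of 1 3]
    by (simp add: pauli_gram_def Let_def mult.commute)
  show "hs_norm N (pauli_gram N M 3) \<le> 2 * (s 0 * s 3 + s 1 * s 2)"
    using add4[of "gram N (M 0) (M 3)" "gram N (M 3) (M 0)" "gram N (M 1) (M 2)" "gram N (M 2) (M 1)"]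
      G[of 0 3] G[of 3 0] G[of 1 2] G[of 2 1]
    by (simp add: pauli_gram_def Let_def mult.commute)
qed

text \<open>The 9 is the inverse square of the factor \<open>1 / 3\<close> per letter. After
  \<open>*\<close>, the sides are compared as quadratic forms in the nonnegative squares
  \<open>P\<close>, \<open>Q\<close>, \<open>R\<close>, \<open>S\<close>: each mixed coefficient is
  10 on the left against 18 or 162 on the right, and each pure one is 1 against 1 or 81.\<close>

lemma hypercontractive_step:
  fixes p q r s :: real
  shows "(p\<^sup>2 + q\<^sup>2 + r\<^sup>2 + s\<^sup>2)\<^sup>2 + (2 * (p * q + r * s))\<^sup>2 + (2 * (p * r + s * q))\<^sup>2
      + (2 * (p * s + q * r))\<^sup>2 \<le> (p\<^sup>2 + 9 * (q\<^sup>2 + r\<^sup>2 + s\<^sup>2))\<^sup>2"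
proof -
  have *: "(2 * (x + y))\<^sup>2 \<le> 8 * x\<^sup>2 + 8 * y\<^sup>2" for x y :: real
    using zero_le_power2[of "x - y"] by (simp add: power2_eq_square algebra_simps)
  define P Q R S where "P = p\<^sup>2" and "Q = q\<^sup>2" and "R = r\<^sup>2" and "S = s\<^sup>2"
  have nn: "0 \<le> P" "0 \<le> Q" "0 \<le> R" "0 \<le> S"
    by (simp_all add: P_def Q_def R_def S_def)
  have "(2 * (p * q + r * s))\<^sup>2 + (2 * (p * r + s * q))\<^sup>2 + (2 * (p * s + q * r))\<^sup>2
      \<le> 8 * (P * Q) + 8 * (R * S) + (8 * (P * R) + 8 * (S * Q)) + (8 * (P * S) + 8 * (Q * R))"
    unfolding P_def Q_def R_def S_def power_mult_distrib[symmetric]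
    by (intro add_mono *)
  moreover have "(P + Q + R + S)\<^sup>2 + (8 * (P * Q) + 8 * (R * S) + (8 * (P * R) + 8 * (S * Q)) + (8 * (P * S) + 8 * (Q * R)))
      \<le> (P + 9 * (Q + R + S))\<^sup>2"
  proof -
    have "0 \<le> P * Q" "0 \<le> P * R" "0 \<le> P * S" "0 \<le> Q * R" "0 \<le> Q * S" "0 \<le> R * S" "0 \<le> Q * Q" "0 \<le> R * R" "0 \<le> S * S"
      using nn by auto
    then show ?thesis
      unfolding power2_eq_square by (simp add: algebra_simps)
  qed
  ultimately show ?thesis
    unfolding P_def Q_def R_def S_def by linarith
qed

text \<open>In normalized form, \<open>\<parallel>T g\<parallel>\<^sub>4\<^sup>2 \<le>
  \<parallel>g\<parallel>\<^sub>2\<^sup>2\<close>; the factor \<open>sqrt (2 ^ n)\<close> comes from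
  the unnormalized norms. The induction peels off the first letter: \<open>M k\<close> is
  \<open>T\<close> on one qubit fewer, applied to the slice \<open>c (k # S)\<close> scaled by
  \<open>r k\<close>.\<close>

lemma hypercontractivity:
  "hs_norm (2 ^ n) (gram (2 ^ n) (pauli_sum n (\<lambda>S. (1 / 3) ^ weight S * c S))
      (pauli_sum n (\<lambda>S. (1 / 3) ^ weight S * c S)))
    \<le> sqrt (2 ^ n) * (\<Sum>S\<in>pauli_strings n. (cmod (c S))\<^sup>2)"
proof (induction n arbitrary: c)
  case 0
  show ?case
    by (simp add: hs_norm_def gram_def weight_def pauli_strings_0 norm_mult power2_eq_square L2_set_def)
next
  case (Suc n)
  define N :: nat where "N = 2 ^ n"
  define r :: "nat \<Rightarrow> real" where "r k = (if k = 0 then 1 else 1 / 3)" for k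
  define M where "M k = pauli_sum n (\<lambda>S. (1 / 3) ^ weight S * (of_real (r k) * c (k # S)))" for k
  define a where "a k = (\<Sum>S\<in>pauli_strings n. (cmod (c (k # S)))\<^sup>2)" for k
  \<comment> \<open>Chosen so that \<open>(s k)\<^sup>2\<close> is exactly the bound that the
    induction hypothesis gives for the slice \<open>M k\<close>.\<close>
  define s where "s k = sqrt (sqrt N) * (r k * sqrt (a k))" for k
  have a: "0 \<le> a k" for k
    unfolding a_def by (intro sum_nonneg) simp
  have r: "0 < r k" for k
    by (simp add: r_def)
  have s: "0 \<le> s k" for k
    unfolding s_def using a r[of k] by (auto intro: mult_nonneg_nonneg)
  have s2: "(s k)\<^sup>2 = sqrt N * ((r k)\<^sup>2 * a k)" for k
    unfolding s_def using a[of k] by (simp add: power_mult_distrib)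
  have h: "hs_norm N (gram N (M k) (M k)) \<le> (s k)\<^sup>2" for k
  proof -
    have "hs_norm N (gram N (M k) (M k)) \<le> sqrt N * (\<Sum>S\<in>pauli_strings n. (cmod (of_real (r k) * c (k # S)))\<^sup>2)"
      unfolding N_def M_def using Suc.IH[of "\<lambda>S. of_real (r k) * c (k # S)"] by simp
    also have "\<dots> = (s k)\<^sup>2"
      by (simp add: s2 a_def norm_mult power_mult_distrib sum_distrib_left)
    finally show ?thesis .
  qed
  have "(hs_norm (2 * N) (pauli_block N (pauli_gram N M)))\<^sup>2
      = 2 * ((hs_norm N (pauli_gram N M 0))\<^sup>2 + (hs_norm N (pauli_gram N M 1))\<^sup>2
        + (hs_norm N (pauli_gram N M 2))\<^sup>2 + (hs_norm N (pauli_gram N M 3))\<^sup>2)"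
    by (simp add: hs_norm_pauli_block sum_lessThan_4)
  also have "\<dots> \<le> 2 * (((s 0)\<^sup>2 + (s 1)\<^sup>2 + (s 2)\<^sup>2 + (s 3)\<^sup>2)\<^sup>2 + (2 * (s 0 * s 1 + s 2 * s 3))\<^sup>2
      + (2 * (s 0 * s 2 + s 3 * s 1))\<^sup>2 + (2 * (s 0 * s 3 + s 1 * s 2))\<^sup>2)"
    by (intro mult_left_mono add_mono power_mono hs_norm_pauli_gram h s) auto
  also have "\<dots> \<le> 2 * ((s 0)\<^sup>2 + 9 * ((s 1)\<^sup>2 + (s 2)\<^sup>2 + (s 3)\<^sup>2))\<^sup>2"
    using hypercontractive_step[of "s 0" "s 1" "s 2" "s 3"] by simp
  also have "\<dots> = (sqrt (2 * N) * (a 0 + a 1 + a 2 + a 3))\<^sup>2"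
  proof -
    \<comment> \<open>The factor 9 cancels \<open>(r k)\<^sup>2 = 1 / 9\<close> at the letters 1, 2,
      3.\<close>
    have "(s 0)\<^sup>2 + 9 * ((s 1)\<^sup>2 + (s 2)\<^sup>2 + (s 3)\<^sup>2) = sqrt N * (a 0 + a 1 + a 2 + a 3)"
      unfolding s2 by (simp add: r_def power2_eq_square algebra_simps)
    then show ?thesis
      by (simp only: power_mult_distrib) simp
  qed
  finally have "hs_norm (2 * N) (pauli_block N (pauli_gram N M)) \<le> sqrt (2 * N) * (a 0 + a 1 + a 2 + a 3)"
    by (rule power2_le_imp_le) (use a in \<open>simp add: add_nonneg_nonneg\<close>)
  moreover have "pauli_sum (Suc n) (\<lambda>S. (1 / 3) ^ weight S * c S) = pauli_block N M"
  proof -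
    have "(1 / 3) ^ weight (k # S) * c (k # S) = (1 / 3) ^ weight S * (of_real (r k) * c (k # S))" for k S
      by (simp add: weight_def r_def)
    then show ?thesis
      unfolding pauli_sum.simps N_def M_def[abs_def] by (simp only:)
  qed
  moreover have "hs_norm (2 * N) (gram (2 * N) (pauli_block N M) (pauli_block N M))
      = hs_norm (2 * N) (pauli_block N (pauli_gram N M))"
    by (intro hs_norm_cong gram_pauli_block)
  moreover have "(\<Sum>S\<in>pauli_strings (Suc n). (cmod (c S))\<^sup>2) = a 0 + a 1 + a 2 + a 3"
    by (simp add: sum_pauli_strings_Suc sum_lessThan_4 a_def)
  ultimately show ?case
    by (simp add: N_def)
qed

section \<open>Hermitian matrices and singular values\<close>

lemma mat_adjoint_carrier [simp]: "A \<in> carrier_mat m n \<Longrightarrow> mat_adjoint A \<in> carrier_mat n m"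
  unfolding mat_adjoint_def by (auto simp: mat_of_rows_def)

lemma mat_adjoint_index [simp]:
  "i < dim_col A \<Longrightarrow> j < dim_row A \<Longrightarrow> mat_adjoint A $$ (i, j) = conjugate (A $$ (j, i))"
  unfolding mat_adjoint_def by (simp add: mat_of_rows_def)

lemma mat_adjoint_dim [simp]: "dim_row (mat_adjoint A) = dim_col A" "dim_col (mat_adjoint A) = dim_row A"
  unfolding mat_adjoint_def by (simp_all add: mat_of_rows_def)

lemma mult_mat_index:
  "A \<in> carrier_mat m n \<Longrightarrow> B \<in> carrier_mat n k \<Longrightarrow> i < m \<Longrightarrow> j < k \<Longrightarrow>
    (A * B) $$ (i, j) = (\<Sum>l<n. A $$ (i, l) * B $$ (l, j))"
  by (auto simp: scalar_prod_def lessThan_atLeast0 intro!: sum.cong)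

lemma mult_mat_vec_index:
  "A \<in> carrier_mat m n \<Longrightarrow> v \<in> carrier_vec n \<Longrightarrow> i < m \<Longrightarrow> (A *\<^sub>v v) $ i = (\<Sum>l<n. A $$ (i, l) * v $ l)"
  by (auto simp: scalar_prod_def lessThan_atLeast0 intro!: sum.cong)

lemma cscalar_prod_sum:
  "w \<in> carrier_vec n \<Longrightarrow> v \<bullet>c w = (\<Sum>l<n. v $ l * conjugate (w $ l))"
  by (auto simp: scalar_prod_def lessThan_atLeast0 intro!: sum.cong)

lemma mat_adjoint_mult:
  fixes A B :: "complex mat"
  assumes "A \<in> carrier_mat m n" "B \<in> carrier_mat n k"
  shows "mat_adjoint (A * B) = mat_adjoint B * mat_adjoint A"
proof (rule eq_matI)
  fix i j assume "i < dim_row (mat_adjoint B * mat_adjoint A)" "j < dim_col (mat_adjoint B * mat_adjoint A)"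
  then have ij: "i < k" "j < m"
    using assms by auto
  have "mat_adjoint (A * B) $$ (i, j) = conjugate ((A * B) $$ (j, i))"
    using ij assms by simp
  also have "\<dots> = (\<Sum>l<n. conjugate (B $$ (l, i)) * conjugate (A $$ (j, l)))"
    using ij assms by (simp add: mult_mat_index[OF assms ij(2,1)] mult.commute del: index_mult_mat(1))
  also have "\<dots> = (mat_adjoint B * mat_adjoint A) $$ (i, j)"
    using ij assms by (simp add: mult_mat_index[of _ k n _ m] del: index_mult_mat(1))
  finally show "mat_adjoint (A * B) $$ (i, j) = (mat_adjoint B * mat_adjoint A) $$ (i, j)" .
qed (use assms in auto)

lemma mat_adjoint_adjoint [simp]: "mat_adjoint (mat_adjoint A) = A"
  by (rule eq_matI) auto

lemma mat_adjoint_one [simp]: "mat_adjoint (1\<^sub>m n :: complex mat) = 1\<^sub>m n"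
  by (rule eq_matI) auto

lemma mat_adjoint_block_diag:
  assumes "A \<in> carrier_mat m m" "D \<in> carrier_mat n n"
  shows "mat_adjoint (four_block_mat A (0\<^sub>m m n) (0\<^sub>m n m) D)
    = four_block_mat (mat_adjoint A) (0\<^sub>m m n) (0\<^sub>m n m) (mat_adjoint D)"
  by (rule eq_matI) (use assms in auto)

lemma diagonal_mat_block_diag:
  assumes "A \<in> carrier_mat 1 1" "D \<in> carrier_mat n n" "diagonal_mat D"
  shows "diagonal_mat (four_block_mat A (0\<^sub>m 1 n) (0\<^sub>m n 1) D)"
  unfolding diagonal_mat_def
proof (intro allI impI)
  fix i j assume "i < dim_row (four_block_mat A (0\<^sub>m 1 n) (0\<^sub>m n 1) D)"
    "j < dim_col (four_block_mat A (0\<^sub>m 1 n) (0\<^sub>m n 1) D)" "i \<noteq> j"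
  then show "four_block_mat A (0\<^sub>m 1 n) (0\<^sub>m n 1) D $$ (i, j) = 0"
    using assms unfolding diagonal_mat_def by (cases i; cases j) auto
qed

lemma mult_block_diag:
  fixes A :: "'a::ring_1 mat"
  assumes "A \<in> carrier_mat m m" "D \<in> carrier_mat n n" "A' \<in> carrier_mat m m" "D' \<in> carrier_mat n n"
  shows "four_block_mat A (0\<^sub>m m n) (0\<^sub>m n m) D * four_block_mat A' (0\<^sub>m m n) (0\<^sub>m n m) D'
    = four_block_mat (A * A') (0\<^sub>m m n) (0\<^sub>m n m) (D * D')"
  by (subst mult_four_block_mat[of _ m m _ n _ n]) (use assms in auto)

text \<open>Gram-Schmidt on a completion of \<open>v\<close> to a basis keeps \<open>v\<close> as
  the first vector; dividing by the lengths makes the columns orthonormal.\<close>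

lemma eigenvector_extends_to_unitary:
  assumes v: "v \<in> carrier_vec n" and v0: "v \<noteq> 0\<^sub>v n"
  obtains U :: "complex mat" and c where "U \<in> carrier_mat n n" "mat_adjoint U * U = 1\<^sub>m n" "col U 0 = c \<cdot>\<^sub>v v"
proof -
  interpret cof_vec_space n "TYPE(complex)" .
  define b where "b = basis_completion v"
  define ws where "ws = gram_schmidt n b"
  note basis = basis_completion[OF v v0, folded b_def]
  have n: "0 < n"
    using v v0 by (cases n) auto
  obtain vs where b: "b = v # vs"
    using basis(6,7) n by (cases b) auto
  from gram_schmidt_result[OF basis(2,4,5) refl, folded ws_def] basis(6)
  have ws: "set ws \<subseteq> carrier_vec n" "corthogonal ws" "length ws = n"
    by auto
  have ws0: "ws ! 0 = v"
    using gram_schmidt_hd[OF v, of vs] ws(3) n hd_conv_nth[of ws] unfolding ws_def b by fastforce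
  define r where "r j = complex_of_real (sqrt (Re (ws ! j \<bullet>c ws ! j)))" for j
  define U where "U = mat n n (\<lambda>(i, j). ws ! j $ i / r j)"
  have U: "U \<in> carrier_mat n n"
    by (simp add: U_def)
  have wsc: "ws ! i \<in> carrier_vec n" if "i < n" for i
    using ws that by auto
  have r2: "r i * r i = ws ! i \<bullet>c ws ! i" "r i \<noteq> 0" "cnj (r i) = r i" if "i < n" for i
  proof -
    have "0 \<le> ws ! i \<bullet>c ws ! i" 
      by (rule conjugate_square_ge_0_vec)
    moreover have "ws ! i \<bullet>c ws ! i \<noteq> 0"
      using corthogonalD[OF ws(2)] that ws(3) by auto
    ultimately show "r i * r i = ws ! i \<bullet>c ws ! i" "r i \<noteq> 0" "cnj (r i) = r i"
      unfolding r_def of_real_mult[symmetric]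
      by (auto simp: less_eq_complex_def complex_eq_iff)
  qed
  have "mat_adjoint U * U = 1\<^sub>m n"
  proof (rule eq_matI)
    fix i j assume "i < dim_row (1\<^sub>m n :: complex mat)" "j < dim_col (1\<^sub>m n :: complex mat)"
    then have ij: "i < n" "j < n" by auto
    have "(mat_adjoint U * U) $$ (i, j) = (ws ! j \<bullet>c ws ! i) / (r i * r j)"
      unfolding cscalar_prod_sum[OF wsc[OF ij(1)]] sum_divide_distrib mult_mat_index[OF mat_adjoint_carrier[OF U] U ij]
      by (intro sum.cong) (use ij U in \<open>simp_all add: U_def r2\<close>)
    also have "\<dots> = 1\<^sub>m n $$ (i, j)"
      using ij r2[OF ij(1)] corthogonalD[OF ws(2), of j i] ws(3) by (cases "i = j") auto
    finally show "(mat_adjoint U * U) $$ (i, j) = 1\<^sub>m n $$ (i, j)" .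
  qed (use U in auto)
  moreover have "col U 0 = (1 / r 0) \<cdot>\<^sub>v v"
    using v n by (intro eq_vecI) (auto simp: U_def ws0)
  ultimately show thesis
    using that U by blast
qed

text \<open>Induction by deflation: a unitary whose first column is an eigenvector clears the first
  column below the corner, Hermiticity clears the first row, and the induction hypothesis
  diagonalizes the remaining block.\<close>

theorem hermitian_diagonalization:
  fixes A :: "complex mat"
  assumes "A \<in> carrier_mat n n" "mat_adjoint A = A"
  obtains U where "U \<in> carrier_mat n n" "mat_adjoint U * U = 1\<^sub>m n" "diagonal_mat (mat_adjoint U * A * U)"
proof -
  have "\<exists>U. U \<in> carrier_mat n n \<and> mat_adjoint U * U = 1\<^sub>m n \<and> diagonal_mat (mat_adjoint U * A * U)"
    using assms
  proof (induction n arbitrary: A)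
    case 0
    then show ?case
      by (intro exI[of _ "1\<^sub>m 0"]) (auto simp: diagonal_mat_def)
  next
    case (Suc n)
    let ?N = "Suc n"
    note A = Suc.prems(1)
    obtain l v where v: "v \<in> carrier_vec ?N" "v \<noteq> 0\<^sub>v ?N" "A *\<^sub>v v = l \<cdot>\<^sub>v v"
      using spectrum_non_empty[OF A] A unfolding spectrum_def eigenvalue_def eigenvector_def by auto
    obtain U c where U: "U \<in> carrier_mat ?N ?N" "mat_adjoint U * U = 1\<^sub>m ?N" and col: "col U 0 = c \<cdot>\<^sub>v v"
      using eigenvector_extends_to_unitary[OF v(1,2)] .
    define A' where "A' = mat_adjoint U * A * U"
    have A': "A' \<in> carrier_mat ?N ?N"
      unfolding A'_def using U A by auto
    have herm: "mat_adjoint A' = A'"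
      unfolding A'_def using U(1) A Suc.prems(2)
      by (simp add: mat_adjoint_mult[of _ ?N ?N _ ?N] assoc_mult_mat[of _ ?N ?N _ ?N _ ?N] mult_carrier_mat[of _ ?N ?N _ ?N])
    \<comment> \<open>The first column of \<open>A * U\<close> is \<open>l\<close> times that of
      \<open>U\<close>, and \<open>mat_adjoint U\<close> sends the latter to the first unit
      vector.\<close>
    have col0: "A' $$ (i, 0) = (if i = 0 then l else 0)" if "i < ?N" for i
    proof -
      have eig: "A *\<^sub>v col U 0 = l \<cdot>\<^sub>v col U 0"
        unfolding col using v A by (simp add: mult_mat_vec smult_smult_assoc mult.commute)
      have AU: "(A * U) $$ (k, 0) = l * U $$ (k, 0)" if "k < ?N" for k
        using arg_cong[OF eig, of "\<lambda>v. v $ k"] that A U(1) by simp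
      have "A' $$ (i, 0) = (mat_adjoint U * (A * U)) $$ (i, 0)"
        unfolding A'_def using U A by (simp add: assoc_mult_mat[of _ ?N ?N _ ?N _ ?N] mult_carrier_mat[of _ ?N ?N _ ?N])
      also have "\<dots> = (\<Sum>k<?N. mat_adjoint U $$ (i, k) * (A * U) $$ (k, 0))"
        using U A that by (intro mult_mat_index) auto
      also have "\<dots> = l * (\<Sum>k<?N. mat_adjoint U $$ (i, k) * U $$ (k, 0))"
        unfolding sum_distrib_left by (intro sum.cong) (simp_all only: AU lessThan_iff mult_ac)
      also have "(\<Sum>k<?N. mat_adjoint U $$ (i, k) * U $$ (k, 0)) = (mat_adjoint U * U) $$ (i, 0)"
        using U A that by (intro mult_mat_index[symmetric]) auto
      finally show ?thesis
        using U(2) that by simp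
    qed
    have row0: "A' $$ (0, i) = (if i = 0 then cnj l else 0)" if "i < ?N" for i
    proof -
      have "A' $$ (0, i) = mat_adjoint A' $$ (0, i)"
        by (simp only: herm)
      then show ?thesis
        using that A' col0[OF that] by auto
    qed
    \<comment> \<open>The two descriptions of the corner entry agree, so the eigenvalue is
      real.\<close>
    have "cnj l = l"
      using col0[of 0] row0[of 0] by simp
    then have row0: "A' $$ (0, i) = (if i = 0 then l else 0)" if "i < ?N" for i
      using row0[OF that] by simp
    define L where "L = mat 1 1 (\<lambda>_. l)"
    define B where "B = mat n n (\<lambda>(i, j). A' $$ (Suc i, Suc j))"
    have L: "L \<in> carrier_mat 1 1" and B: "B \<in> carrier_mat n n"
      by (auto simp: L_def B_def)
    have A'_block: "A' = four_block_mat L (0\<^sub>m 1 n) (0\<^sub>m n 1) B"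
      by (rule eq_matI) (use A' col0 row0 in \<open>auto simp: L_def B_def\<close>)
    have "mat_adjoint B = B"
    proof (rule eq_matI)
      fix i j assume "i < dim_row B" "j < dim_col B"
      then have ij: "i < n" "j < n"
        using B by auto
      have "mat_adjoint A' $$ (Suc i, Suc j) = A' $$ (Suc i, Suc j)"
        by (simp only: herm)
      then show "mat_adjoint B $$ (i, j) = B $$ (i, j)"
        using ij A' by (simp add: B_def)
    qed (use B in auto)
    then obtain V where V: "V \<in> carrier_mat n n" "mat_adjoint V * V = 1\<^sub>m n" "diagonal_mat (mat_adjoint V * B * V)"
      using Suc.IH[OF B] by blast
    define W where "W = four_block_mat (1\<^sub>m 1) (0\<^sub>m 1 n) (0\<^sub>m n 1) V"
    have W: "W \<in> carrier_mat ?N ?N"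
      using V four_block_carrier_mat[of "1\<^sub>m 1" 1 1 V n n] unfolding W_def by simp
    have Wadj: "mat_adjoint W = four_block_mat (1\<^sub>m 1) (0\<^sub>m 1 n) (0\<^sub>m n 1) (mat_adjoint V)"
      unfolding W_def using V by (simp add: mat_adjoint_block_diag)
    have WW: "mat_adjoint W * W = 1\<^sub>m ?N"
      unfolding Wadj unfolding W_def using V by (simp add: mult_block_diag)
    have "mat_adjoint (U * W) * (U * W) = mat_adjoint W * ((mat_adjoint U * U) * W)"
      using U(1) W by (simp add: mat_adjoint_mult[of _ ?N ?N _ ?N] assoc_mult_mat[of _ ?N ?N _ ?N _ ?N] mult_carrier_mat[of _ ?N ?N _ ?N])
    then have 1: "mat_adjoint (U * W) * (U * W) = 1\<^sub>m ?N"
      using U W WW by simp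
    have "mat_adjoint (U * W) * A * (U * W) = mat_adjoint W * A' * W"
      unfolding A'_def using U(1) W A by (simp add: mat_adjoint_mult[of _ ?N ?N _ ?N] assoc_mult_mat[of _ ?N ?N _ ?N _ ?N] mult_carrier_mat[of _ ?N ?N _ ?N])
    also have "\<dots> = four_block_mat L (0\<^sub>m 1 n) (0\<^sub>m n 1) (mat_adjoint V * B * V)"
      unfolding Wadj A'_block using V B L unfolding W_def
      by (simp add: mult_block_diag mult_carrier_mat[of _ n n _ n])
    finally have "mat_adjoint (U * W) * A * (U * W) = four_block_mat L (0\<^sub>m 1 n) (0\<^sub>m n 1) (mat_adjoint V * B * V)" .
    moreover have "diagonal_mat (four_block_mat L (0\<^sub>m 1 n) (0\<^sub>m n 1) (mat_adjoint V * B * V))"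
      by (rule diagonal_mat_block_diag) (use V L B in \<open>auto intro: mult_carrier_mat[of _ n n]\<close>)
    ultimately have "diagonal_mat (mat_adjoint (U * W) * A * (U * W))"
      by simp
    then show ?case
      using 1 mult_carrier_mat[OF U(1) W] by blast
  qed
  then show thesis
    using that by blast
qed

section \<open>Positive semidefinite square roots and the modulus\<close>

lemma csquare_nonneg: "0 \<le> z * cnj z"
  by (simp add: less_eq_complex_def)

text \<open>This makes the positive square root unique. Since \<open>(Q + s) (Q - s) u = 0\<close>,
  the vector \<open>w = (Q - s) u\<close> satisfies \<open>Q w = - s w\<close>, and positivity
  forces \<open>w = 0\<close> when \<open>s > 0\<close>. The case \<open>s = 0\<close> needs a
  separate argument.\<close>

lemma pos_semidef_square_eigenvector:
  assumes Q: "Q \<in> carrier_mat n n" "pos_semidef Q" and u: "u \<in> carrier_vec n" and s: "0 \<le> s"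
    and eq: "Q *\<^sub>v (Q *\<^sub>v u) = complex_of_real (s\<^sup>2) \<cdot>\<^sub>v u"
  shows "Q *\<^sub>v u = complex_of_real s \<cdot>\<^sub>v u"
proof -
  have psd: "0 \<le> (Q *\<^sub>v v) \<bullet>c v" if "v \<in> carrier_vec n" for v
    using Q that unfolding pos_semidef_def by auto
  define w where "w = Q *\<^sub>v u - complex_of_real s \<cdot>\<^sub>v u"
  have Qu: "Q *\<^sub>v u \<in> carrier_vec n" and w: "w \<in> carrier_vec n"
    using Q u by (auto simp: w_def)
  have Qw: "Q *\<^sub>v w = complex_of_real (- s) \<cdot>\<^sub>v w"
    unfolding w_def using Q u eq Qu
    by (simp add: mult_minus_distrib_mat_vec[of _ n n] mult_mat_vec[of _ n n])
      (auto simp: algebra_simps power2_eq_square)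
  have w0: "w \<bullet>c w = 0"
  proof (cases "s = 0")
    case False
    have "(Q *\<^sub>v w) \<bullet>c w = complex_of_real (- s) * (w \<bullet>c w)"
      unfolding Qw using w by simp
    then show ?thesis
      using psd[OF w] conjugate_square_ge_0_vec[of w] s False
      by (auto simp: less_eq_complex_def complex_eq_iff mult_le_0_iff)
  next
    case True
    then have Quw: "Q *\<^sub>v u = w" and Qw: "Q *\<^sub>v w = 0\<^sub>v n"
      using Qw w Qu u Q(1) by (auto simp: w_def intro!: eq_vecI)
    show ?thesis
    proof (rule ccontr)
      assume nz: "w \<bullet>c w \<noteq> 0"
      text \<open>If \<open>Q w = 0\<close>, the form at \<open>u + t w\<close> is affine in the real number \<open>t\<close>, with slope \<open>\<langle>w, w\<rangle>\<close>.\<close>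
      define t where "t = - (w \<bullet>c u + 1) / (w \<bullet>c w)"
      have uw: "w \<bullet>c u \<ge> 0"
        using psd[OF u] Quw by simp
      have "cnj (w \<bullet>c w) = w \<bullet>c w" "cnj (w \<bullet>c u) = w \<bullet>c u"
        using conjugate_square_ge_0_vec[of w] uw by (auto simp: less_eq_complex_def complex_eq_iff)
      then have t: "cnj t = t"
        by (simp add: t_def)
      have "t \<cdot>\<^sub>v 0\<^sub>v n = 0\<^sub>v n"
        by (rule eq_vecI) auto
      then have "Q *\<^sub>v (u + t \<cdot>\<^sub>v w) = w"
        using Q u w Quw Qw by (simp add: mult_add_distrib_mat_vec[of _ n n] mult_mat_vec[of _ n n])
      then have "(Q *\<^sub>v (u + t \<cdot>\<^sub>v w)) \<bullet>c (u + t \<cdot>\<^sub>v w) = w \<bullet>c u + t * (w \<bullet>c w)"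
        using u w t by (simp add: conjugate_add_vec[of _ n] conjugate_smult_vec scalar_prod_add_distrib[of _ n])
      also have "\<dots> = - 1"
        using nz by (simp add: t_def)
      finally show False
        using psd[of "u + t \<cdot>\<^sub>v w"] u w by (simp add: less_eq_complex_def)
    qed
  qed
  then have w_0: "w = 0\<^sub>v n"
    using conjugate_square_eq_0_vec[OF w] by simp
  show ?thesis
  proof (rule eq_vecI)
    fix i assume "i < dim_vec (complex_of_real s \<cdot>\<^sub>v u)"
    then have i: "i < n"
      using u by simp
    have "w $ i = (Q *\<^sub>v u) $ i - (complex_of_real s \<cdot>\<^sub>v u) $ i"
      unfolding w_def by (rule index_minus_vec) (use i u in simp)
    then show "(Q *\<^sub>v u) $ i = (complex_of_real s \<cdot>\<^sub>v u) $ i"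
      using i by (simp add: w_0 del: index_mult_mat_vec)
  qed (use Q u in auto)
qed

lemma cscalar_prod_adjoint:
  fixes A :: "complex mat"
  assumes A: "A \<in> carrier_mat m n" and x: "x \<in> carrier_vec n" and y: "y \<in> carrier_vec m"
  shows "(A *\<^sub>v x) \<bullet>c y = x \<bullet>c (mat_adjoint A *\<^sub>v y)"
proof -
  have "(A *\<^sub>v x) \<bullet>c y = (\<Sum>i<m. \<Sum>j<n. A $$ (i, j) * x $ j * cnj (y $ i))"
    unfolding cscalar_prod_sum[OF y]
    by (intro sum.cong refl) (use assms in \<open>simp add: mult_mat_vec_index[OF A x] sum_distrib_right del: index_mult_mat_vec\<close>)
  also have "\<dots> = (\<Sum>j<n. \<Sum>i<m. A $$ (i, j) * x $ j * cnj (y $ i))"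
    by (rule sum.swap)
  also have "\<dots> = x \<bullet>c (mat_adjoint A *\<^sub>v y)"
    unfolding cscalar_prod_sum[OF mult_mat_vec_carrier[OF mat_adjoint_carrier[OF A] y]]
    by (intro sum.cong refl)
      (use assms in \<open>simp add: mult_mat_vec_index[OF mat_adjoint_carrier[OF A] y] sum_distrib_left mult_ac del: index_mult_mat_vec\<close>)
  finally show ?thesis .
qed

lemma gram_matrix_eq:
  assumes "A \<in> carrier_mat m n" "i < n" "j < n"
  shows "(mat_adjoint A * A) $$ (i, j) = (\<Sum>k<m. cnj (A $$ (k, i)) * A $$ (k, j))"
  using assms by (simp add: mult_mat_index[OF mat_adjoint_carrier[OF assms(1)]] del: index_mult_mat(1))

text \<open>\<open>U\<close> diagonalizes \<open>A\<^sup>*A\<close>, so the columns of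
  \<open>A * U\<close> are orthogonal and their lengths \<open>s i\<close> are the singular values.
  As \<open>mat_abs\<close> is a definite description, evaluating it takes both existence and
  uniqueness of the positive square root.\<close>

lemma singular_value_decomposition:
  fixes A :: "complex mat"
  assumes A: "A \<in> carrier_mat n n"
  obtains U s where "U \<in> carrier_mat n n" "mat_adjoint U * U = 1\<^sub>m n" "\<And>i. i < n \<Longrightarrow> 0 \<le> s i"
    "\<And>i j. i < n \<Longrightarrow> j < n \<Longrightarrow>
       (\<Sum>k<n. cnj ((A * U) $$ (k, i)) * (A * U) $$ (k, j)) = (if i = j then complex_of_real ((s i)\<^sup>2) else 0)"
    "mat_abs A = U * mat n n (\<lambda>(i, j). if i = j then complex_of_real (s i) else 0) * mat_adjoint U"
    "mat_abs A * mat_abs A = mat_adjoint A * A"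
proof -
  define B where "B = mat_adjoint A * A"
  have B: "B \<in> carrier_mat n n" "mat_adjoint B = B"
    using A by (auto simp: B_def mat_adjoint_mult[of _ n n _ n])
  obtain U where U: "U \<in> carrier_mat n n" "mat_adjoint U * U = 1\<^sub>m n" "diagonal_mat (mat_adjoint U * B * U)"
    using hermitian_diagonalization[OF B] .
  have U': "U * mat_adjoint U = 1\<^sub>m n"
    using mat_mult_left_right_inverse[of "mat_adjoint U" n U] U by auto
  note assoc = assoc_mult_mat[of _ n n _ n _ n] mult_carrier_mat[of _ n n _ n]
  have AU: "A * U \<in> carrier_mat n n"
    using A U by auto
  define s where "s i = sqrt (\<Sum>k<n. (cmod ((A * U) $$ (k, i)))\<^sup>2)" for i
  have s: "0 \<le> s i" for i
    by (simp add: s_def sum_nonneg)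
  have BU: "mat_adjoint U * B * U = mat_adjoint (A * U) * (A * U)"
    unfolding B_def using A U(1)
    by (simp add: mat_adjoint_mult[of _ n n _ n] assoc)
  have diag: "(mat_adjoint U * B * U) $$ (i, j) = (if i = j then complex_of_real ((s i)\<^sup>2) else 0)"
    if ij: "i < n" "j < n" for i j
  proof (cases "i = j")
    case True
    have "(mat_adjoint U * B * U) $$ (i, i) = complex_of_real (\<Sum>k<n. (cmod ((A * U) $$ (k, i)))\<^sup>2)"
      unfolding BU gram_matrix_eq[OF AU ij(1) ij(1)] of_real_sum complex_norm_square
      by (intro sum.cong) (simp_all add: mult.commute)
    then show ?thesis
      using True by (simp add: s_def sum_nonneg)
  next
    case False
    then show ?thesis
      using U(1,3) B(1) ij unfolding diagonal_mat_def by auto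
  qed
  define S where "S = mat n n (\<lambda>(i, j). if i = j then complex_of_real (s i) else 0)"
  have S: "S \<in> carrier_mat n n"
    by (simp add: S_def)
  define P where "P = U * S * mat_adjoint U"
  have P: "P \<in> carrier_mat n n"
    using U S by (auto simp: P_def)
  have SS: "S * S = mat_adjoint U * B * U"
  proof (rule eq_matI)
    fix i j assume "i < dim_row (mat_adjoint U * B * U)" "j < dim_col (mat_adjoint U * B * U)"
    then have ij: "i < n" "j < n"
      using U by auto
    have "(S * S) $$ (i, j) = (\<Sum>k<n. S $$ (i, k) * S $$ (k, j))"
      by (rule mult_mat_index[OF S S ij])
    also have "\<dots> = (\<Sum>k<n. if k = i then complex_of_real (s i) * S $$ (i, j) else 0)"
      by (intro sum.cong) (use ij in \<open>auto simp: S_def\<close>)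
    also have "\<dots> = (mat_adjoint U * B * U) $$ (i, j)"
      unfolding diag[OF ij] using ij by (simp add: S_def power2_eq_square)
    finally show "(S * S) $$ (i, j) = (mat_adjoint U * B * U) $$ (i, j)" .
  qed (use S U in auto)
  have "P * P = U * (S * ((mat_adjoint U * U) * S)) * mat_adjoint U"
    unfolding P_def using U(1) S by (simp add: assoc)
  also have "\<dots> = U * (mat_adjoint U * B * U) * mat_adjoint U"
    using U S SS by simp
  also have "\<dots> = (U * mat_adjoint U) * B * (U * mat_adjoint U)"
    using U(1) B(1) by (simp add: assoc)
  finally have PP: "P * P = B"
    using U' B by simp
  \<comment> \<open>The form at \<open>v\<close> is the sum of \<open>s i\<close> times the squared
    moduli of the coordinates of \<open>U\<^sup>*v\<close>.\<close>
  have Ppsd: "pos_semidef P"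
    unfolding pos_semidef_def
  proof (intro conjI ballI)
    show "square_mat P"
      using P by auto
    fix v :: "complex vec" assume "v \<in> carrier_vec (dim_row P)"
    then have v: "v \<in> carrier_vec n"
      using P by auto
    define w where "w = mat_adjoint U *\<^sub>v v"
    have w: "w \<in> carrier_vec n"
      unfolding w_def by (rule mult_mat_vec_carrier[OF mat_adjoint_carrier[OF U(1)] v])
    have "(P *\<^sub>v v) \<bullet>c v = (U *\<^sub>v (S *\<^sub>v w)) \<bullet>c v"
      unfolding P_def w_def using U(1) S v by (simp add: assoc_mult_mat_vec[of _ n n _ n] mult_mat_vec_carrier[of _ n n])
    also have "\<dots> = (S *\<^sub>v w) \<bullet>c w"
      using cscalar_prod_adjoint[OF U(1) mult_mat_vec_carrier[OF S w] v] by (simp add: w_def)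
    also have "\<dots> = (\<Sum>i<n. complex_of_real (s i) * (w $ i * cnj (w $ i)))"
      unfolding cscalar_prod_sum[OF w]
    proof (intro sum.cong refl)
      fix i assume "i \<in> {..<n}"
      then have i: "i < n" by simp
      have "(S *\<^sub>v w) $ i = (\<Sum>l<n. S $$ (i, l) * w $ l)"
        by (rule mult_mat_vec_index[OF S w i])
      also have "\<dots> = (\<Sum>l<n. if l = i then complex_of_real (s i) * w $ i else 0)"
        by (intro sum.cong) (use i in \<open>auto simp: S_def\<close>)
      finally show "(S *\<^sub>v w) $ i * conjugate (w $ i) = complex_of_real (s i) * (w $ i * cnj (w $ i))"
        using i by simp
    qed
    also have "0 \<le> \<dots>"
      using s by (intro sum_nonneg mult_nonneg_nonneg csquare_nonneg) (simp add: less_eq_complex_def)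
    finally show "0 \<le> (P *\<^sub>v v) \<bullet>c v" .
  qed
  \<comment> \<open>Every column of \<open>U\<close> is an eigenvector of \<open>Q * Q\<close>, so
    \<open>pos_semidef_square_eigenvector\<close> determines \<open>Q\<close> on it. Hence
    \<open>Q * U = U * S\<close>, and \<open>U\<close> can be moved to the other side.\<close>
  have unique: "Q = P" if Q: "Q \<in> carrier_mat n n" "pos_semidef Q" "Q * Q = B" for Q
  proof -
    have "Q * U = U * S"
    proof (rule eq_matI)
      fix i j assume "i < dim_row (U * S)" "j < dim_col (U * S)"
      then have ij: "i < n" "j < n"
        using U S by auto
      define u where "u = col U j"
      have u: "u \<in> carrier_vec n"
        using U ij by (auto simp: u_def)
      have US: "(U * X) $$ (k, j) = U $$ (k, j) * X $$ (j, j)"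
        if "k < n" "X \<in> carrier_mat n n" "\<And>i. i < n \<Longrightarrow> i \<noteq> j \<Longrightarrow> X $$ (i, j) = 0" for k X
      proof -
        have "(U * X) $$ (k, j) = (\<Sum>l<n. U $$ (k, l) * X $$ (l, j))"
          by (rule mult_mat_index) (use U ij that in auto)
        also have "\<dots> = (\<Sum>l<n. if l = j then U $$ (k, j) * X $$ (j, j) else 0)"
          by (intro sum.cong) (use that in auto)
        finally show ?thesis
          using ij by simp
      qed
      have "Q *\<^sub>v (Q *\<^sub>v u) = B *\<^sub>v u"
        using assoc_mult_mat_vec[OF Q(1) Q(1) u] Q(3) by simp
      also have "\<dots> = complex_of_real ((s j)\<^sup>2) \<cdot>\<^sub>v u"
      proof (rule eq_vecI)
        fix k assume "k < dim_vec (complex_of_real ((s j)\<^sup>2) \<cdot>\<^sub>v u)"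
        then have k: "k < n"
          using u by simp
        have M: "mat_adjoint U * B * U \<in> carrier_mat n n"
          using U(1) B(1) by (simp add: assoc)
        have "B * U = U * (mat_adjoint U * B * U)"
        proof -
          have "U * (mat_adjoint U * B * U) = (U * mat_adjoint U) * (B * U)"
            using U(1) B(1) by (simp add: assoc)
          then show ?thesis
            using U' U(1) B(1) by simp
        qed
        moreover have "(U * (mat_adjoint U * B * U)) $$ (k, j) = U $$ (k, j) * (mat_adjoint U * B * U) $$ (j, j)"
          by (rule US[OF k M]) (simp only: diag ij if_False)
        ultimately have "(B * U) $$ (k, j) = U $$ (k, j) * complex_of_real ((s j)\<^sup>2)"
          by (simp only: diag[OF ij(2) ij(2)] simp_thms if_True)
        then show "(B *\<^sub>v u) $ k = (complex_of_real ((s j)\<^sup>2) \<cdot>\<^sub>v u) $ k"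
          using k ij U B by (simp add: u_def)
      qed (use B u in auto)
      finally have "Q *\<^sub>v u = complex_of_real (s j) \<cdot>\<^sub>v u"
        by (intro pos_semidef_square_eigenvector[OF Q(1,2) u s])
      then have "(Q *\<^sub>v u) $ i = complex_of_real (s j) * u $ i"
        using u ij by simp
      then have "(Q * U) $$ (i, j) = complex_of_real (s j) * U $$ (i, j)"
        using ij Q(1) U(1) by (simp add: u_def)
      moreover have "(U * S) $$ (i, j) = U $$ (i, j) * S $$ (j, j)"
        by (rule US[OF ij(1) S]) (use ij in \<open>simp add: S_def\<close>)
      ultimately show "(Q * U) $$ (i, j) = (U * S) $$ (i, j)"
        using ij by (simp add: S_def)
    qed (use Q U S in auto)
    then have "Q * (U * mat_adjoint U) = P"
      unfolding P_def using Q(1) U(1) by (simp add: assoc_mult_mat[of _ n n _ n _ n, symmetric])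
    then show ?thesis
      using Q U' by simp
  qed
  have "mat_abs A = P"
    unfolding mat_abs_def
  proof (rule the_equality)
    show "P \<in> carrier_mat (dim_col A) (dim_col A) \<and> pos_semidef P \<and> P * P = mat_adjoint A * A"
      using P Ppsd PP unfolding carrier_matD(2)[OF A] B_def by blast
    show "Q = P" if "Q \<in> carrier_mat (dim_col A) (dim_col A) \<and> pos_semidef Q \<and> Q * Q = mat_adjoint A * A" for Q
    proof (rule unique)
      show "Q \<in> carrier_mat n n"
        using that unfolding carrier_matD(2)[OF A] by (rule conjunct1)
      show "pos_semidef Q"
        using that by (elim conjE)
      show "Q * Q = B"
        using that unfolding B_def by (elim conjE)
    qed
  qed
  then have "mat_abs A = U * mat n n (\<lambda>(i, j). if i = j then complex_of_real (s i) else 0) * mat_adjoint U"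
    "mat_abs A * mat_abs A = mat_adjoint A * A"
    using PP by (simp_all only: P_def S_def B_def)
  moreover have "(\<Sum>k<n. cnj ((A * U) $$ (k, i)) * (A * U) $$ (k, j)) = (if i = j then complex_of_real ((s i)\<^sup>2) else 0)"
    if "i < n" "j < n" for i j
    using diag[OF that] unfolding BU gram_matrix_eq[OF AU that] .
  ultimately show thesis
    using that[OF U(1,2) s] by (simp only:)
qed

section \<open>Trace norm duality\<close>

definition mat_prod :: "nat \<Rightarrow> (nat \<Rightarrow> nat \<Rightarrow> complex) \<Rightarrow> (nat \<Rightarrow> nat \<Rightarrow> complex) \<Rightarrow> nat \<Rightarrow> nat \<Rightarrow> complex" where
  "mat_prod N X V i j = (\<Sum>k<N. X i k * V k j)"

definition col_norm :: "nat \<Rightarrow> (nat \<Rightarrow> nat \<Rightarrow> complex) \<Rightarrow> nat \<Rightarrow> real" where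
  "col_norm N X i = L2_set (\<lambda>k. cmod (X k i)) {..<N}"

lemma col_norm_nonneg [simp]: "0 \<le> col_norm N X i"
  by (simp add: col_norm_def)

lemma col_norm_power2: "(col_norm N X i)\<^sup>2 = (\<Sum>k<N. (cmod (X k i))\<^sup>2)"
  unfolding col_norm_def L2_set_def by (simp add: sum_nonneg)

lemma hs_norm_col_norm: "(hs_norm N X)\<^sup>2 = (\<Sum>i<N. (col_norm N X i)\<^sup>2)"
  unfolding hs_norm_power2 col_norm_power2 by (rule sum.swap)

lemma col_inner_le: "cmod (\<Sum>k<N. cnj (X k i) * Y k j) \<le> col_norm N X i * col_norm N Y j"
proof -
  have "cmod (\<Sum>k<N. cnj (X k i) * Y k j) \<le> (\<Sum>k<N. \<bar>cmod (X k i)\<bar> * \<bar>cmod (Y k j)\<bar>)"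
    by (rule sum_norm_le) (simp add: norm_mult)
  also have "\<dots> \<le> col_norm N X i * col_norm N Y j"
    unfolding col_norm_def by (rule L2_set_mult_ineq)
  finally show ?thesis .
qed

lemma hs_inner_le_col_norms: "cmod (hs_inner N X Y) \<le> (\<Sum>i<N. col_norm N X i * col_norm N Y i)"
proof -
  have "hs_inner N X Y = (\<Sum>i<N. \<Sum>k<N. cnj (X k i) * Y k i)"
    unfolding hs_inner_def by (rule sum.swap)
  then show ?thesis
    using col_inner_le by (auto intro!: sum_norm_le)
qed

text \<open>The hypothesis is \<open>V V\<^sup>* = 1\<close>, which cancels the two copies of
  \<open>V\<close> once the sum over \<open>j\<close> is innermost.\<close>

lemma hs_inner_mult_unitary:
  assumes V: "\<And>k l. k < N \<Longrightarrow> l < N \<Longrightarrow> (\<Sum>i<N. V k i * cnj (V l i)) = (if k = l then 1 else 0)"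
  shows "hs_inner N (mat_prod N X V) (mat_prod N Y V) = hs_inner N X Y"
proof -
  have "(\<Sum>j<N. cnj (mat_prod N X V i j) * mat_prod N Y V i j) = (\<Sum>k<N. cnj (X i k) * Y i k)" for i
  proof -
    have "(\<Sum>j<N. cnj (mat_prod N X V i j) * mat_prod N Y V i j)
        = (\<Sum>j<N. \<Sum>k<N. \<Sum>l<N. cnj (X i k) * Y i l * (V l j * cnj (V k j)))"
      unfolding mat_prod_def cnj_sum sum_product by (simp add: mult_ac)
    also have "\<dots> = (\<Sum>k<N. \<Sum>j<N. \<Sum>l<N. cnj (X i k) * Y i l * (V l j * cnj (V k j)))"
      by (rule sum.swap)
    also have "\<dots> = (\<Sum>k<N. \<Sum>l<N. \<Sum>j<N. cnj (X i k) * Y i l * (V l j * cnj (V k j)))"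
      by (intro sum.cong refl sum.swap)
    also have "\<dots> = (\<Sum>k<N. \<Sum>l<N. if l = k then cnj (X i k) * Y i k else 0)"
      unfolding sum_distrib_left[symmetric] by (intro sum.cong refl) (auto simp: V)
    finally show ?thesis
      by simp
  qed
  then show ?thesis
    unfolding hs_inner_def by simp
qed

lemma hs_norm_mult_unitary:
  assumes "\<And>k l. k < N \<Longrightarrow> l < N \<Longrightarrow> (\<Sum>i<N. V k i * cnj (V l i)) = (if k = l then 1 else 0)"
  shows "hs_norm N (mat_prod N X V) = hs_norm N X"
proof -
  have "complex_of_real ((hs_norm N (mat_prod N X V))\<^sup>2) = of_real ((hs_norm N X)\<^sup>2)"
    unfolding hs_inner_self[symmetric] by (rule hs_inner_mult_unitary[OF assms])
  then have "(hs_norm N (mat_prod N X V))\<^sup>2 = (hs_norm N X)\<^sup>2"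
    using of_real_eq_iff by blast
  then show ?thesis
    by simp
qed

text \<open>For a column \<open>v\<close> of \<open>V\<close>, the squared length of
  \<open>Y v\<close> is the inner product of \<open>v\<close> with \<open>Y\<^sup>*Y v\<close>;
  Cauchy-Schwarz does the rest.\<close>

lemma col_norm_mult_le:
  "(col_norm N (mat_prod N Y V) i)\<^sup>2 \<le> col_norm N V i * col_norm N (mat_prod N (gram N Y Y) V) i"
proof -
  have "complex_of_real ((col_norm N (mat_prod N Y V) i)\<^sup>2)
      = (\<Sum>k<N. cnj (mat_prod N Y V k i) * mat_prod N Y V k i)"
    unfolding col_norm_power2 of_real_sum complex_norm_square by (simp add: mult.commute)
  also have "\<dots> = (\<Sum>k<N. \<Sum>l<N. \<Sum>m<N. cnj (V l i) * (cnj (Y k l) * Y k m * V m i))"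
    unfolding mat_prod_def cnj_sum sum_product by (simp add: mult_ac)
  also have "\<dots> = (\<Sum>l<N. \<Sum>k<N. \<Sum>m<N. cnj (V l i) * (cnj (Y k l) * Y k m * V m i))"
    by (rule sum.swap)
  also have "\<dots> = (\<Sum>l<N. \<Sum>m<N. \<Sum>k<N. cnj (V l i) * (cnj (Y k l) * Y k m * V m i))"
    by (intro sum.cong refl sum.swap)
  also have "\<dots> = (\<Sum>l<N. cnj (V l i) * mat_prod N (gram N Y Y) V l i)"
    unfolding mat_prod_def gram_def by (simp add: sum_distrib_left sum_distrib_right)
  finally have "cmod (complex_of_real ((col_norm N (mat_prod N Y V) i)\<^sup>2))
      = cmod (\<Sum>l<N. cnj (V l i) * mat_prod N (gram N Y Y) V l i)"
    by (rule arg_cong)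
  then have "(col_norm N (mat_prod N Y V) i)\<^sup>2 = cmod (\<Sum>l<N. cnj (V l i) * mat_prod N (gram N Y Y) V l i)"
    by (simp del: of_real_power)
  then show ?thesis
    using col_inner_le[of V i "mat_prod N (gram N Y Y) V" i N] by simp
qed

section \<open>Operator norm and trace norm\<close>

lemma euclid_norm_L2_set: "euclid_norm v = L2_set (\<lambda>k. cmod (v $ k)) {..<dim_vec v}"
proof -
  have "v \<bullet>c v = complex_of_real (\<Sum>k<dim_vec v. (cmod (v $ k))\<^sup>2)"
    unfolding cscalar_prod_sum[OF carrier_vec_dim_vec] of_real_sum complex_norm_square by simp
  then show ?thesis
    by (simp add: euclid_norm_def L2_set_def)
qed

text \<open>A real \<open>SUP\<close> dominates its members only over a bounded set; on the unit
  ball the sum of the moduli of all entries is a bound.\<close>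

lemma euclid_norm_mult_le_op_norm:
  assumes H: "H \<in> carrier_mat N N" and v: "v \<in> carrier_vec N" "euclid_norm v \<le> 1"
  shows "euclid_norm (H *\<^sub>v v) \<le> op_norm H"
proof -
  have "bdd_above ((\<lambda>v. euclid_norm (H *\<^sub>v v)) ` {v \<in> carrier_vec (dim_col H). euclid_norm v \<le> 1})"
  proof (rule bdd_aboveI2)
    fix v assume "v \<in> {v \<in> carrier_vec (dim_col H). euclid_norm v \<le> 1}"
    then have v: "v \<in> carrier_vec N" "euclid_norm v \<le> 1"
      using H by auto
    have bound: "cmod ((H *\<^sub>v v) $ i) \<le> (\<Sum>j<N. cmod (H $$ (i, j)))" if "i < N" for i
    proof -
      have "cmod (v $ j) \<le> 1" if "j < N" for j
      proof -
        have "cmod (v $ j) \<le> L2_set (\<lambda>k. cmod (v $ k)) {..<N}"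
          by (rule member_le_L2_set) (use that in auto)
        then show ?thesis
          using v by (simp add: euclid_norm_L2_set)
      qed
      then show ?thesis
        unfolding mult_mat_vec_index[OF H v(1) that]
        by (intro sum_norm_le) (simp add: norm_mult mult_left_le)
    qed
    have "euclid_norm (H *\<^sub>v v) \<le> (\<Sum>i<N. cmod ((H *\<^sub>v v) $ i))"
      unfolding euclid_norm_L2_set using H by (simp add: L2_set_le_sum del: index_mult_mat_vec)
    also have "\<dots> \<le> (\<Sum>i<N. \<Sum>j<N. cmod (H $$ (i, j)))"
      by (intro sum_mono bound) simp
    finally show "euclid_norm (H *\<^sub>v v) \<le> (\<Sum>i<N. \<Sum>j<N. cmod (H $$ (i, j)))" .
  qed
  then show ?thesis
    unfolding op_norm_def by (rule cSUP_upper[rotated]) (use H v in auto)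
qed

abbreviation entries :: "complex mat \<Rightarrow> nat \<Rightarrow> nat \<Rightarrow> complex" where
  "entries A \<equiv> \<lambda>i j. A $$ (i, j)"

text \<open>Unnormalized: \<open>schatten_norm n 1\<close> is this divided by
  \<open>2 ^ n\<close>.\<close>

definition trace_norm :: "complex mat \<Rightarrow> real" where
  "trace_norm A = Re (mat_trace (mat_abs A))"

lemma mat_trace_mult:
  assumes "A \<in> carrier_mat m n" "B \<in> carrier_mat n m"
  shows "mat_trace (A * B) = (\<Sum>i<m. \<Sum>k<n. A $$ (i, k) * B $$ (k, i))"
  using assms by (auto simp: mat_trace_def mult_mat_index[OF assms] simp del: index_mult_mat(1))

text \<open>The decomposition above in entrywise form. With the right singular vectors as columns of
  \<open>V\<close>, the singular values are the column lengths of \<open>A V\<close>, so both norms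
  of \<open>A\<close> can be estimated column by column.\<close>

lemma trace_norm_singular_values:
  assumes A: "A \<in> carrier_mat N N"
  obtains V where
    "\<And>k l. k < N \<Longrightarrow> l < N \<Longrightarrow> (\<Sum>i<N. V k i * cnj (V l i)) = (if k = l then 1 else 0)"
    "\<And>i. i < N \<Longrightarrow> col_norm N V i = 1"
    "trace_norm A = (\<Sum>i<N. col_norm N (mat_prod N (entries A) V) i)"
    "Re (mat_trace (mat_abs A ^\<^sub>m 2)) = (hs_norm N (entries A))\<^sup>2"
proof -
  obtain U s where U: "U \<in> carrier_mat N N" "mat_adjoint U * U = 1\<^sub>m N" and s: "\<And>i. i < N \<Longrightarrow> 0 \<le> s i"
    and sing: "\<And>i j. i < N \<Longrightarrow> j < N \<Longrightarrow>
       (\<Sum>k<N. cnj ((A * U) $$ (k, i)) * (A * U) $$ (k, j)) = (if i = j then complex_of_real ((s i)\<^sup>2) else 0)"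
    and abs: "mat_abs A = U * mat N N (\<lambda>(i, j). if i = j then complex_of_real (s i) else 0) * mat_adjoint U"
    and sq: "mat_abs A * mat_abs A = mat_adjoint A * A"
    by (rule singular_value_decomposition[OF A]) (rule that)
  define S where "S = mat N N (\<lambda>(i, j). if i = j then complex_of_real (s i) else 0)"
  have S: "S \<in> carrier_mat N N"
    by (simp add: S_def)
  note Ua = mat_adjoint_carrier[OF U(1)]
  have U': "U * mat_adjoint U = 1\<^sub>m N"
    using mat_mult_left_right_inverse[OF Ua U(1) U(2)] .
  have 1: "(\<Sum>i<N. U $$ (k, i) * cnj (U $$ (l, i))) = (if k = l then 1 else 0)" if "k < N" "l < N" for k l
  proof -
    have "(\<Sum>i<N. U $$ (k, i) * cnj (U $$ (l, i))) = (U * mat_adjoint U) $$ (k, l)"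
      unfolding mult_mat_index[OF U(1) Ua that] by (intro sum.cong refl) (use U that in simp)
    then show ?thesis
      using U' that by simp
  qed
  have U2: "(\<Sum>k<N. cnj (U $$ (k, i)) * U $$ (k, j)) = (if i = j then 1 else 0)" if "i < N" "j < N" for i j
    using gram_matrix_eq[OF U(1) that] U(2) that by simp
  have 2: "col_norm N (entries U) i = 1" if "i < N" for i
  proof -
    have "complex_of_real ((col_norm N (entries U) i)\<^sup>2) = 1"
      unfolding col_norm_power2 of_real_sum complex_norm_square
      using U2[OF that that] by (simp add: mult.commute)
    then have "(col_norm N (entries U) i)\<^sup>2 = 1\<^sup>2"
      unfolding of_real_eq_1_iff by simp
    then show ?thesis
      unfolding power2_eq_iff_nonneg[OF col_norm_nonneg zero_le_one] .
  qed
  have AU: "mat_prod N (entries A) (entries U) k i = (A * U) $$ (k, i)" if "k < N" "i < N" for k i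
    unfolding mat_prod_def by (rule mult_mat_index[OF A U(1) that, symmetric])
  have cs: "col_norm N (mat_prod N (entries A) (entries U)) i = s i" if "i < N" for i
  proof -
    have "complex_of_real ((col_norm N (mat_prod N (entries A) (entries U)) i)\<^sup>2) = complex_of_real ((s i)\<^sup>2)"
      unfolding col_norm_power2 of_real_sum complex_norm_square
      using sing[OF that that] that by (simp add: AU mult.commute)
    then have "(col_norm N (mat_prod N (entries A) (entries U)) i)\<^sup>2 = (s i)\<^sup>2"
      using of_real_eq_iff by blast
    then show ?thesis
      using s[OF that] by simp
  qed
  have "mat_trace (mat_abs A) = (\<Sum>i<N. \<Sum>k<N. (U * S) $$ (i, k) * mat_adjoint U $$ (k, i))"
    unfolding abs S_def[symmetric] by (rule mat_trace_mult[OF mult_carrier_mat[OF U(1) S] Ua])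
  also have "\<dots> = (\<Sum>i<N. \<Sum>k<N. complex_of_real (s k) * (cnj (U $$ (i, k)) * U $$ (i, k)))"
  proof (intro sum.cong refl)
    fix i k assume "i \<in> {..<N}" "k \<in> {..<N}"
    then have ik: "i < N" "k < N" by auto
    have "(U * S) $$ (i, k) = (\<Sum>l<N. U $$ (i, l) * S $$ (l, k))"
      by (rule mult_mat_index[OF U(1) S ik])
    also have "\<dots> = (\<Sum>l<N. if l = k then U $$ (i, k) * complex_of_real (s k) else 0)"
      by (intro sum.cong) (use ik in \<open>auto simp: S_def\<close>)
    finally show "(U * S) $$ (i, k) * mat_adjoint U $$ (k, i) = complex_of_real (s k) * (cnj (U $$ (i, k)) * U $$ (i, k))"
      using ik U(1) by simp
  qed
  also have "\<dots> = (\<Sum>k<N. complex_of_real (s k) * (\<Sum>i<N. cnj (U $$ (i, k)) * U $$ (i, k)))"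
    unfolding sum_distrib_left by (rule sum.swap)
  also have "\<dots> = complex_of_real (\<Sum>k<N. s k)"
    using U2 by simp
  finally have 3: "trace_norm A = (\<Sum>i<N. col_norm N (mat_prod N (entries A) (entries U)) i)"
    unfolding trace_norm_def by (simp add: cs)
  have P: "mat_abs A \<in> carrier_mat N N"
    unfolding abs S_def[symmetric] using U(1) S by (simp add: mult_carrier_mat[of _ N N _ N])
  have "mat_abs A ^\<^sub>m 2 = mat_adjoint A * A"
    using P sq by (simp add: numeral_2_eq_2)
  then have "mat_trace (mat_abs A ^\<^sub>m 2) = mat_trace (mat_adjoint A * A)"
    by simp
  also have "\<dots> = (\<Sum>i<N. \<Sum>k<N. mat_adjoint A $$ (i, k) * A $$ (k, i))"
    by (rule mat_trace_mult[OF mat_adjoint_carrier[OF A] A])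
  also have "\<dots> = (\<Sum>i<N. \<Sum>k<N. cnj (A $$ (k, i)) * A $$ (k, i))"
    by (intro sum.cong refl) (use A in simp)
  also have "\<dots> = hs_inner N (entries A) (entries A)"
    unfolding hs_inner_def by (rule sum.swap)
  finally have "Re (mat_trace (mat_abs A ^\<^sub>m 2)) = (hs_norm N (entries A))\<^sup>2"
    by (simp add: hs_inner_self)
  then show thesis
    using that[OF 1 2 3] by blast
qed

lemma trace_norm_nonneg:
  assumes "A \<in> carrier_mat N N"
  shows "0 \<le> trace_norm A"
proof -
  obtain V where "trace_norm A = (\<Sum>i<N. col_norm N (mat_prod N (entries A) V) i)"
    by (rule trace_norm_singular_values[OF assms]) (rule that)
  then show ?thesis
    by (simp add: sum_nonneg)
qed

lemma trace_mat_abs_square: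
  assumes "A \<in> carrier_mat N N"
  shows "Re (mat_trace (mat_abs A ^\<^sub>m 2)) = (hs_norm N (entries A))\<^sup>2"
  by (rule trace_norm_singular_values[OF assms])

lemma sum_mult_power2_le:
  fixes a b :: "'a \<Rightarrow> real"
  shows "(\<Sum>i\<in>I. a i * b i)\<^sup>2 \<le> (\<Sum>i\<in>I. (a i)\<^sup>2) * (\<Sum>i\<in>I. (b i)\<^sup>2)"
proof -
  have "\<bar>\<Sum>i\<in>I. a i * b i\<bar> \<le> (\<Sum>i\<in>I. \<bar>a i\<bar> * \<bar>b i\<bar>)"
    by (rule order.trans[OF sum_abs]) (simp add: abs_mult)
  also have "\<dots> \<le> L2_set a I * L2_set b I"
    by (rule L2_set_mult_ineq)
  finally have "(\<Sum>i\<in>I. a i * b i)\<^sup>2 \<le> (L2_set a I * L2_set b I)\<^sup>2"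
    by (rule power2_le_iff_abs_le[THEN iffD2, rotated]) simp
  then show ?thesis
    by (simp add: power_mult_distrib L2_set_def sum_nonneg)
qed

text \<open>Multiplying both matrices by \<open>V\<close> preserves the pairing. The contraction
  \<open>H\<close> sends the unit columns of \<open>V\<close> to vectors of length at most 1, so
  columnwise Cauchy-Schwarz leaves the sum of the singular values of \<open>A\<close>.\<close>

lemma trace_norm_dual:
  assumes A: "A \<in> carrier_mat N N" and H: "H \<in> carrier_mat N N" "op_norm H \<le> 1"
  shows "cmod (hs_inner N (entries A) (entries H)) \<le> trace_norm A"
proof -
  obtain V where V: "\<And>k l. k < N \<Longrightarrow> l < N \<Longrightarrow> (\<Sum>i<N. V k i * cnj (V l i)) = (if k = l then 1 else 0)"
    "\<And>i. i < N \<Longrightarrow> col_norm N V i = 1"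
    "trace_norm A = (\<Sum>i<N. col_norm N (mat_prod N (entries A) V) i)"
    by (rule trace_norm_singular_values[OF A]) (rule that)
  have le1: "col_norm N (mat_prod N (entries H) V) i \<le> 1" if "i < N" for i
  proof -
    define v where "v = vec N (\<lambda>k. V k i)"
    have v: "v \<in> carrier_vec N"
      by (simp add: v_def)
    have "euclid_norm v = col_norm N V i"
      unfolding euclid_norm_L2_set col_norm_def by (rule L2_set_cong) (simp_all add: v_def)
    then have "euclid_norm v = 1"
      using V(2)[OF that] by simp
    then have "euclid_norm (H *\<^sub>v v) \<le> 1"
      using euclid_norm_mult_le_op_norm[OF H(1) v] H(2) by simp
    moreover have "euclid_norm (H *\<^sub>v v) = col_norm N (mat_prod N (entries H) V) i"
      unfolding euclid_norm_L2_set col_norm_def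
    proof (rule L2_set_cong)
      show "{..<dim_vec (H *\<^sub>v v)} = {..<N}"
        using H by simp
      fix k assume "k \<in> {..<N}"
      then show "cmod ((H *\<^sub>v v) $ k) = cmod (mat_prod N (entries H) V k i)"
        unfolding mat_prod_def
        by (subst mult_mat_vec_index[OF H(1) v]) (simp_all add: v_def)
    qed
    ultimately show ?thesis
      by simp
  qed
  have "cmod (hs_inner N (entries A) (entries H))
      \<le> (\<Sum>i<N. col_norm N (mat_prod N (entries A) V) i * col_norm N (mat_prod N (entries H) V) i)"
    using hs_inner_le_col_norms[of N "mat_prod N (entries A) V" "mat_prod N (entries H) V"]
    by (simp add: hs_inner_mult_unitary[OF V(1)])
  also have "\<dots> \<le> trace_norm A"
    unfolding V(3) by (intro sum_mono) (simp add: le1 mult_left_le)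
  finally show ?thesis .
qed

text \<open>Interpolation of \<open>\<parallel>A\<parallel>\<^sub>4\<^sub>/\<^sub>3\<close> between the trace norm and the Hilbert--Schmidt norm, in dual form.\<close>

lemma hs_inner_le_trace_norm:
  assumes A: "A \<in> carrier_mat N N"
  shows "(cmod (hs_inner N (entries A) Y))\<^sup>2 \<le> trace_norm A * (hs_norm N (entries A) * hs_norm N (gram N Y Y))"
proof -
  obtain V where V: "\<And>k l. k < N \<Longrightarrow> l < N \<Longrightarrow> (\<Sum>i<N. V k i * cnj (V l i)) = (if k = l then 1 else 0)"
    "\<And>i. i < N \<Longrightarrow> col_norm N V i = 1"
    "trace_norm A = (\<Sum>i<N. col_norm N (mat_prod N (entries A) V) i)"
    by (rule trace_norm_singular_values[OF A]) (rule that)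
  define s where "s i = col_norm N (mat_prod N (entries A) V) i" for i
  define y where "y i = col_norm N (mat_prod N Y V) i" for i
  define g where "g i = col_norm N (mat_prod N (gram N Y Y) V) i" for i
  have s: "0 \<le> s i" for i
    by (simp add: s_def)
  have "cmod (hs_inner N (entries A) Y) \<le> (\<Sum>i<N. s i * y i)"
    using hs_inner_le_col_norms[of N "mat_prod N (entries A) V" "mat_prod N Y V"]
    by (simp add: hs_inner_mult_unitary[OF V(1)] s_def y_def)
  then have "(cmod (hs_inner N (entries A) Y))\<^sup>2 \<le> (\<Sum>i<N. s i * y i)\<^sup>2"
    by (intro power_mono) auto
  \<comment> \<open>Splitting \<open>s i\<close> evenly between two factors makes one of the two
    sums the trace norm.\<close>
  also have "\<dots> = (\<Sum>i<N. sqrt (s i) * (sqrt (s i) * y i))\<^sup>2"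
    using s by (simp add: mult.assoc[symmetric])
  also have "\<dots> \<le> (\<Sum>i<N. (sqrt (s i))\<^sup>2) * (\<Sum>i<N. (sqrt (s i) * y i)\<^sup>2)"
    by (rule sum_mult_power2_le)
  also have "\<dots> = trace_norm A * (\<Sum>i<N. s i * (y i)\<^sup>2)"
    using s by (simp add: V(3) s_def power_mult_distrib)
  also have "\<dots> \<le> trace_norm A * (hs_norm N (entries A) * hs_norm N (gram N Y Y))"
  proof (rule mult_left_mono)
    \<comment> \<open>As the columns of \<open>V\<close> are unit vectors,
      \<open>col_norm_mult_le\<close> gives \<open>(y i)\<^sup>2 \<le> g i\<close>. Cauchy-Schwarz
      then returns to Hilbert-Schmidt norms, which \<open>V\<close> preserves.\<close>
    have "(\<Sum>i<N. s i * (y i)\<^sup>2) \<le> (\<Sum>i<N. \<bar>s i\<bar> * \<bar>g i\<bar>)"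
    proof (intro sum_mono mult_mono)
      fix i assume "i \<in> {..<N}"
      then show "(y i)\<^sup>2 \<le> \<bar>g i\<bar>"
        using col_norm_mult_le[of N Y V i] V(2)[of i] by (simp add: y_def g_def)
    qed (use s in auto)
    also have "\<dots> \<le> L2_set s {..<N} * L2_set g {..<N}"
      by (rule L2_set_mult_ineq)
    also have "L2_set s {..<N} = hs_norm N (mat_prod N (entries A) V)"
      unfolding L2_set_def s_def hs_norm_col_norm[symmetric] by simp
    also have "L2_set g {..<N} = hs_norm N (mat_prod N (gram N Y Y) V)"
      unfolding L2_set_def g_def hs_norm_col_norm[symmetric] by simp
    finally show "(\<Sum>i<N. s i * (y i)\<^sup>2) \<le> hs_norm N (entries A) * hs_norm N (gram N Y Y)"
      by (simp add: hs_norm_mult_unitary[OF V(1)])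
  qed (rule trace_norm_nonneg[OF A])
  finally show ?thesis .
qed

section \<open>The difference operators on Pauli expansions\<close>

lemma pauli_sum_add: "pauli_sum n (\<lambda>S. c S + d S) i j = pauli_sum n c i j + pauli_sum n d i j"
proof (induction n arbitrary: c d i j)
  case (Suc n)
  show ?case
    unfolding pauli_sum.simps pauli_block_def Suc.IH by (simp add: algebra_simps)
qed simp

lemma pauli_sum_mult: "pauli_sum n (\<lambda>S. u * c S) i j = u * pauli_sum n c i j"
proof (induction n arbitrary: c i j)
  case (Suc n)
  show ?case
    unfolding pauli_sum.simps pauli_block_def Suc.IH by (simp add: algebra_simps)
qed simp

text \<open>The coefficients of the quadrant \<open>(a, b)\<close>: \<open>c (k # S)\<close> is
  weighted by the entry at \<open>(a, b)\<close> of the Pauli matrix \<open>k\<close>, with a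
  nonzero index read as 1.\<close>

definition block_coeffs :: "nat \<Rightarrow> nat \<Rightarrow> (nat list \<Rightarrow> complex) \<Rightarrow> nat list \<Rightarrow> complex" where
  "block_coeffs a b c S =
    (if a = 0 then if b = 0 then c (0 # S) + c (3 # S) else c (1 # S) - \<i> * c (2 # S)
     else if b = 0 then c (1 # S) + \<i> * c (2 # S) else c (0 # S) - c (3 # S))"

lemma pauli_sum_Suc:
  assumes "a < 2" "b < 2" "i < 2 ^ n" "j < 2 ^ n"
  shows "pauli_sum (Suc n) c (a * 2 ^ n + i) (b * 2 ^ n + j) = pauli_sum n (block_coeffs a b c) i j"
proof -
  have "a = 0 \<or> a = 1" "b = 0 \<or> b = 1"
    using assms by auto
  then show ?thesis
    using assms(3,4)
    by (auto simp: block_coeffs_def[abs_def] pauli_block_def pauli_sum_add pauli_sum_diff pauli_sum_mult)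
qed

definition pauli_mat :: "nat \<Rightarrow> (nat list \<Rightarrow> complex) \<Rightarrow> complex mat" where
  "pauli_mat n c = mat (2 ^ n) (2 ^ n) (\<lambda>(i, j). pauli_sum n c i j)"

definition mat_block :: "nat \<Rightarrow> nat \<Rightarrow> nat \<Rightarrow> complex mat \<Rightarrow> complex mat" where
  "mat_block n a b A = mat (2 ^ n) (2 ^ n) (\<lambda>(i, j). A $$ (a * 2 ^ n + i, b * 2 ^ n + j))"

lemma pauli_mat_carrier [simp]: "pauli_mat n c \<in> carrier_mat (2 ^ n) (2 ^ n)"
  by (simp add: pauli_mat_def)

lemma digit_bound: "a < 2 \<Longrightarrow> i < 2 ^ n \<Longrightarrow> a * 2 ^ n + i < (2 ^ Suc n :: nat)"
proof -
  assume "a < 2" "i < 2 ^ n"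
  then have "a * 2 ^ n \<le> 1 * 2 ^ n"
    by (intro mult_right_mono) auto
  then show ?thesis
    using \<open>i < 2 ^ n\<close> unfolding power_Suc by linarith
qed

lemma pauli_mat_Suc_index:
  "a < 2 \<Longrightarrow> i < 2 ^ n \<Longrightarrow> b < 2 \<Longrightarrow> j < 2 ^ n \<Longrightarrow>
    pauli_mat (Suc n) c $$ (a * 2 ^ n + i, b * 2 ^ n + j) = pauli_mat n (block_coeffs a b c) $$ (i, j)"
  unfolding pauli_mat_def using digit_bound[of a i n] digit_bound[of b j n]
  by (simp add: pauli_sum_Suc del: pauli_sum.simps power_Suc)

lemma mat_block_pauli_mat:
  "a < 2 \<Longrightarrow> b < 2 \<Longrightarrow> mat_block n a b (pauli_mat (Suc n) c) = pauli_mat n (block_coeffs a b c)"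
  unfolding mat_block_def pauli_mat_def using digit_bound
  by (intro eq_matI) (auto simp: pauli_sum_Suc simp del: pauli_sum.simps power_Suc)

section \<open>Tensor maps, one factor at a time\<close>

lemma kron_list_carrier:
  "(\<And>M. M \<in> set Ms \<Longrightarrow> M \<in> carrier_mat 2 2) \<Longrightarrow> kron_list Ms \<in> carrier_mat (2 ^ length Ms) (2 ^ length Ms)"
proof (induction Ms)
  case (Cons M Ms)
  have "kron_list (M # Ms) = kron M (kron_list Ms)"
    by (simp add: kron_list_def)
  moreover have "M \<in> carrier_mat 2 2" "kron_list Ms \<in> carrier_mat (2 ^ length Ms) (2 ^ length Ms)"
    using Cons by auto
  ultimately show ?case
    by (auto simp: kron_def)
qed (simp add: kron_list_def)

lemma kron_list_Cons_index:
  assumes M: "M \<in> carrier_mat 2 2" and Ms: "\<And>M. M \<in> set Ms \<Longrightarrow> M \<in> carrier_mat 2 2"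
    and n: "length Ms = n" and r: "a < 2" "i < 2 ^ n" and s: "b < 2" "j < 2 ^ n"
  shows "kron_list (M # Ms) $$ (a * 2 ^ n + i, b * 2 ^ n + j) = M $$ (a, b) * kron_list Ms $$ (i, j)"
proof -
  have K: "kron_list Ms \<in> carrier_mat (2 ^ n) (2 ^ n)"
    using kron_list_carrier[of Ms] Ms n by blast
  have "kron_list (M # Ms) = kron M (kron_list Ms)"
    by (simp add: kron_list_def)
  then show ?thesis
    using M K r s digit_bound[OF r] digit_bound[OF s] by (simp add: kron_def)
qed

lemma qdigit_0: "a < 2 \<Longrightarrow> i < 2 ^ n \<Longrightarrow> qdigit (Suc n) 0 (a * 2 ^ n + i) = a"
  by (simp add: qdigit_def)

text \<open>After division by a power of 2 below \<open>2 ^ n\<close>, the leading digit contributes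
  an even number, which \<open>mod 2\<close> removes.\<close>

lemma qdigit_Suc:
  assumes "k < n"
  shows "qdigit (Suc n) (Suc k) (a * 2 ^ n + i) = qdigit n k i"
proof -
  define m where "m = n - 1 - k"
  have n: "n = m + Suc k"
    using assms by (simp add: m_def)
  have "(a * 2 ^ n + i) div 2 ^ m = (i + (2 * (a * 2 ^ k)) * 2 ^ m) div 2 ^ m"
    unfolding n by (simp add: power_add algebra_simps)
  also have "\<dots> = 2 * (a * 2 ^ k) + i div 2 ^ m"
    by (rule div_mult_self1) simp
  finally have "(a * 2 ^ n + i) div 2 ^ m mod 2 = i div 2 ^ m mod 2"
    by simp
  then show ?thesis
    by (simp add: qdigit_def m_def)
qed

lemma sum_digit_split: "(\<Sum>x<2 ^ Suc n. f x) = (\<Sum>a<2. \<Sum>i<2 ^ n. f (a * 2 ^ n + i))"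
  for f :: "nat \<Rightarrow> 'a::comm_monoid_add"
  using sum_lessThan_double[of f "2 ^ n"] by (simp add: sum.distrib numeral_2_eq_2 add.commute)

text \<open>The leading factor \<open>T\<close> mixes the four quadrants of \<open>A\<close>, while
  the other factors act inside each quadrant. This drives the inductions on the number of
  qubits.\<close>

lemma tensor_map_Cons_index:
  assumes T: "\<And>a b. T (mat_unit a b) \<in> carrier_mat 2 2"
    and Ts: "\<And>T a b. T \<in> set Ts \<Longrightarrow> T (mat_unit a b) \<in> carrier_mat 2 2"
    and n: "length Ts = n" and r: "p < 2" "i < 2 ^ n" and s: "q < 2" "j < 2 ^ n"
  shows "tensor_map (T # Ts) A $$ (p * 2 ^ n + i, q * 2 ^ n + j)
    = (\<Sum>a<2. \<Sum>b<2. T (mat_unit a b) $$ (p, q) * tensor_map Ts (mat_block n a b A) $$ (i, j))"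
proof -
  define K where "K x y = kron_list (map (\<lambda>i. (Ts ! i) (mat_unit (qdigit n i x) (qdigit n i y))) [0..<n])" for x y
  have TA: "tensor_map Ts B $$ (i, j) = (\<Sum>x<2 ^ n. \<Sum>y<2 ^ n. B $$ (x, y) * K x y $$ (i, j))" for B
    unfolding tensor_map_def Let_def n K_def using r s by simp
  have kron: "kron_list (map (\<lambda>i. ((T # Ts) ! i) (mat_unit (qdigit (Suc n) i (a * 2 ^ n + x))
        (qdigit (Suc n) i (b * 2 ^ n + y)))) [0..<Suc n]) $$ (p * 2 ^ n + i, q * 2 ^ n + j)
      = T (mat_unit a b) $$ (p, q) * K x y $$ (i, j)"
    if "a < 2" "b < 2" "x < 2 ^ n" "y < 2 ^ n" for a b x y
  proof -
    have "map (\<lambda>i. ((T # Ts) ! i) (mat_unit (qdigit (Suc n) i (a * 2 ^ n + x)) (qdigit (Suc n) i (b * 2 ^ n + y)))) [0..<Suc n]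
        = T (mat_unit a b) # map (\<lambda>i. (Ts ! i) (mat_unit (qdigit n i x) (qdigit n i y))) [0..<n]"
      unfolding map_upt_Suc using that by (simp add: qdigit_0 qdigit_Suc)
    then show ?thesis
      unfolding K_def using n Ts by (subst kron_list_Cons_index[symmetric]) (use T r s in auto)
  qed
  have "tensor_map (T # Ts) A $$ (p * 2 ^ n + i, q * 2 ^ n + j)
      = (\<Sum>u<2 ^ Suc n. \<Sum>v<2 ^ Suc n. A $$ (u, v) *
          kron_list (map (\<lambda>i. ((T # Ts) ! i) (mat_unit (qdigit (Suc n) i u) (qdigit (Suc n) i v))) [0..<Suc n])
            $$ (p * 2 ^ n + i, q * 2 ^ n + j))"
    unfolding tensor_map_def Let_def using digit_bound[OF r] digit_bound[OF s] n
    by (simp del: power_Suc upt_Suc)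
  also have "\<dots> = (\<Sum>a<2. \<Sum>x<2 ^ n. \<Sum>b<2. \<Sum>y<2 ^ n. A $$ (a * 2 ^ n + x, b * 2 ^ n + y) *
      (T (mat_unit a b) $$ (p, q) * K x y $$ (i, j)))"
    unfolding sum_digit_split by (intro sum.cong refl arg_cong2[where f = "(*)"] kron) simp_all
  also have "\<dots> = (\<Sum>a<2. \<Sum>b<2. \<Sum>x<2 ^ n. \<Sum>y<2 ^ n. A $$ (a * 2 ^ n + x, b * 2 ^ n + y) *
      (T (mat_unit a b) $$ (p, q) * K x y $$ (i, j)))"
    by (intro sum.cong refl sum.swap)
  also have "\<dots> = (\<Sum>a<2. \<Sum>b<2. T (mat_unit a b) $$ (p, q) * tensor_map Ts (mat_block n a b A) $$ (i, j))"
    unfolding TA sum_distrib_left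
    by (intro sum.cong refl) (simp add: mat_block_def mult_ac)
  finally show ?thesis .
qed

lemma mat_unit_carrier [simp]: "mat_unit a b \<in> carrier_mat 2 2"
  by (simp add: mat_unit_def)

lemma sum_lessThan_2: "(\<Sum>i<2. f i) = f 0 + f 1" for f :: "nat \<Rightarrow> 'a::comm_monoid_add"
  by (simp add: numeral_2_eq_2)

lemma digits_cases:
  assumes "r < 2 ^ Suc n"
  obtains a i where "a < 2" "i < 2 ^ n" "r = a * 2 ^ n + (i::nat)"
proof
  show "r div 2 ^ n < 2"
    using assms by (simp add: less_mult_imp_div_less)
  show "r mod 2 ^ n < 2 ^ n" "r = r div 2 ^ n * 2 ^ n + r mod 2 ^ n"
    by (simp_all only: div_mult_mod_eq) simp
qed

lemma tensor_map_dim [simp]: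
  "dim_row (tensor_map Ts A) = 2 ^ length Ts" "dim_col (tensor_map Ts A) = 2 ^ length Ts"
  by (simp_all add: tensor_map_def Let_def)

lemma tensor_map_id_Cons_index:
  assumes "\<And>T a b. T \<in> set Ts \<Longrightarrow> T (mat_unit a b) \<in> carrier_mat 2 2"
    and "length Ts = n" and p: "p < 2" "i < 2 ^ n" and q: "q < 2" "j < 2 ^ n"
  shows "tensor_map ((\<lambda>X. X) # Ts) A $$ (p * 2 ^ n + i, q * 2 ^ n + j) = tensor_map Ts (mat_block n p q A) $$ (i, j)"
proof -
  have "p = 0 \<or> p = 1" "q = 0 \<or> q = 1"
    using p q by auto
  then show ?thesis
    by (subst tensor_map_Cons_index) (use assms in \<open>auto simp: sum_lessThan_2 mat_unit_def\<close>)
qed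

lemma tensor_map_id:
  "A \<in> carrier_mat (2 ^ n) (2 ^ n) \<Longrightarrow> tensor_map (replicate n (\<lambda>X. X)) A = A"
proof (induction n arbitrary: A)
  case 0
  then show ?case
    by (intro eq_matI) (auto simp: tensor_map_def kron_list_def)
next
  case (Suc n)
  show ?case
  proof (rule eq_matI)
    fix r s assume "r < dim_row A" "s < dim_col A"
    then obtain p i q j where r: "p < 2" "i < 2 ^ n" "r = p * 2 ^ n + i" and s: "q < 2" "j < 2 ^ n" "s = q * 2 ^ n + j"
      using Suc.prems digits_cases by (metis carrier_matD)
    have "tensor_map (replicate (Suc n) (\<lambda>X. X)) A $$ (r, s) = mat_block n p q A $$ (i, j)"
      unfolding r(3) s(3) replicate_Suc using r s
      by (subst tensor_map_id_Cons_index) (auto simp: Suc.IH mat_block_def)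
    then show "tensor_map (replicate (Suc n) (\<lambda>X. X)) A $$ (r, s) = A $$ (r, s)"
      using r s by (simp add: mat_block_def)
  qed (use Suc.prems in auto)
qed

text \<open>The one-qubit difference annihilates the identity and fixes the other three Pauli
  matrices. The induction strips the identity maps in front of it; the base case inspects the four
  quadrants.\<close>

lemma tensor_map_diff_pauli_mat:
  "tensor_map (replicate k (\<lambda>X. X) @ [\<lambda>X. X - (mat_trace X / 2) \<cdot>\<^sub>m 1\<^sub>m 2] @ replicate m (\<lambda>X. X)) (pauli_mat (k + Suc m) c)
    = pauli_mat (k + Suc m) (\<lambda>S. if S ! k = 0 then 0 else c S)"
proof (induction k arbitrary: c)
  case 0
  let ?T = "\<lambda>X. X - (mat_trace X / 2) \<cdot>\<^sub>m 1\<^sub>m 2"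
  let ?c = "\<lambda>S. if S ! 0 = 0 then 0 else c S"
  show ?case
  proof (rule eq_matI)
    fix r s assume "r < dim_row (pauli_mat (0 + Suc m) ?c)" "s < dim_col (pauli_mat (0 + Suc m) ?c)"
    then have rs: "r < 2 ^ Suc m" "s < 2 ^ Suc m"
      by (simp_all add: pauli_mat_def)
    obtain p i where r: "p < 2" "i < 2 ^ m" "r = p * 2 ^ m + i"
      by (rule digits_cases[OF rs(1)]) (rule that)
    obtain q j where s: "q < 2" "j < 2 ^ m" "s = q * 2 ^ m + j"
      by (rule digits_cases[OF rs(2)]) (rule that)
    have pq: "p = 0 \<or> p = 1" "q = 0 \<or> q = 1"
      using r s by auto
    have id: "tensor_map (replicate m (\<lambda>X. X)) (pauli_mat m d) $$ (i, j) = pauli_sum m d i j" for d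
      by (subst tensor_map_id) (use r s in \<open>auto simp: pauli_mat_def\<close>)
    have "tensor_map (?T # replicate m (\<lambda>X. X)) (pauli_mat (Suc m) c) $$ (r, s)
        = (\<Sum>a<2. \<Sum>b<2. ?T (mat_unit a b) $$ (p, q) * pauli_sum m (block_coeffs a b c) i j)"
      unfolding r(3) s(3) using r s
      by (subst tensor_map_Cons_index) (auto simp: mat_block_pauli_mat id)
    also have "\<dots> = pauli_sum m (block_coeffs p q ?c) i j"
      \<comment> \<open>In the quadrant \<open>(1, 1)\<close> only \<open>- c (3 # S)\<close>
        survives, so linearity is needed at the scalar -1.\<close>
      using pq pauli_sum_mult[of m "- 1" "\<lambda>S. c (3 # S)" i j] by (auto simp: sum_lessThan_2 mat_unit_def mat_trace_def block_coeffs_def[abs_def]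
          pauli_sum_add pauli_sum_diff pauli_sum_mult pauli_sum_zero field_simps)
    also have "\<dots> = pauli_mat (Suc m) ?c $$ (r, s)"
      unfolding r(3) s(3) pauli_mat_Suc_index[OF r(1,2) s(1,2)] using r s by (simp add: pauli_mat_def)
    finally show "tensor_map (replicate 0 (\<lambda>X. X) @ [?T] @ replicate m (\<lambda>X. X)) (pauli_mat (0 + Suc m) c) $$ (r, s)
        = pauli_mat (0 + Suc m) ?c $$ (r, s)"
      by simp
  qed (auto simp: pauli_mat_def)
next
  case (Suc k)
  let ?n = "k + Suc m"
  let ?Ts = "replicate k (\<lambda>X. X) @ [\<lambda>X. X - (mat_trace X / 2) \<cdot>\<^sub>m 1\<^sub>m 2] @ replicate m (\<lambda>X. X)"
  let ?c = "\<lambda>S. if S ! Suc k = 0 then 0 else c S"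
  show ?case
  proof (rule eq_matI)
    fix r s assume "r < dim_row (pauli_mat (Suc k + Suc m) ?c)" "s < dim_col (pauli_mat (Suc k + Suc m) ?c)"
    then have rs: "r < 2 ^ Suc ?n" "s < 2 ^ Suc ?n"
      by (simp_all add: pauli_mat_def)
    obtain p i where r: "p < 2" "i < 2 ^ ?n" "r = p * 2 ^ ?n + i"
      by (rule digits_cases[OF rs(1)]) (rule that)
    obtain q j where s: "q < 2" "j < 2 ^ ?n" "s = q * 2 ^ ?n + j"
      by (rule digits_cases[OF rs(2)]) (rule that)
    have "tensor_map ((\<lambda>X. X) # ?Ts) (pauli_mat (Suc ?n) c) $$ (r, s)
        = tensor_map ?Ts (mat_block ?n p q (pauli_mat (Suc ?n) c)) $$ (i, j)"
      unfolding r(3) s(3) by (rule tensor_map_id_Cons_index) (use r s in auto)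
    also have "\<dots> = pauli_mat ?n (\<lambda>S. if S ! k = 0 then 0 else block_coeffs p q c S) $$ (i, j)"
      unfolding mat_block_pauli_mat[OF r(1) s(1)] Suc.IH ..
    \<comment> \<open>A leading letter shifts positions by one,
      \<open>(x # S) ! Suc k = S ! k\<close>, so discarding strings commutes with passing to a
      quadrant.\<close>
    also have "(\<lambda>S. if S ! k = 0 then 0 else block_coeffs p q c S) = block_coeffs p q ?c"
      by (auto simp: block_coeffs_def)
    also have "pauli_mat ?n (block_coeffs p q ?c) $$ (i, j) = pauli_mat (Suc ?n) ?c $$ (r, s)"
      unfolding r(3) s(3) by (rule pauli_mat_Suc_index[symmetric, OF r(1,2) s(1,2)])
    finally show "tensor_map (replicate (Suc k) (\<lambda>X. X) @ [\<lambda>X. X - (mat_trace X / 2) \<cdot>\<^sub>m 1\<^sub>m 2] @ replicate m (\<lambda>X. X))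
        (pauli_mat (Suc k + Suc m) c) $$ (r, s) = pauli_mat (Suc k + Suc m) ?c $$ (r, s)"
      by simp
  qed (auto simp: pauli_mat_def)
qed

text \<open>Qubits are numbered from 1 and list positions from 0, hence
  \<open>j - 1\<close>.\<close>

lemma qdiff_pauli_mat:
  assumes "1 \<le> j" "j \<le> n"
  shows "qdiff n j (pauli_mat n c) = pauli_mat n (\<lambda>S. if S ! (j - 1) = 0 then 0 else c S)"
  using tensor_map_diff_pauli_mat[of "j - 1" "n - j" c] assms by (simp add: qdiff_def)

section \<open>The Talagrand-type inequality\<close>

text \<open>Choice of the cut-off \<open>m\<close>. With \<open>L = ln (1 / t)\<close>, the factor
  \<open>sqrt t\<close> decays like \<open>exp (- L / 2)\<close>, and \<open>9 ^ m\<close> is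
  allowed to use up half of this decay. For \<open>t \<ge> 1\<close> the logarithm vanishes and
  \<open>W \<le> t\<close> suffices.\<close>

lemma talagrand_scalar_bound:
  fixes t W :: real
  assumes t: "0 < t" and Wt: "W \<le> t"
    and Wm: "\<And>m. 1 \<le> m \<Longrightarrow> W \<le> 9 ^ m * (t * sqrt t) + t / real m"
  shows "W \<le> 49 * (t * (1 + t) / (1 + log_plus (1 / t)) powr (1 / 2))"
proof (cases "1 \<le> t")
  case True
  then have "ln (1 / t) \<le> 0"
    using t by (simp add: ln_div)
  then have "log_plus (1 / t) = 0"
    by (simp add: log_plus_def)
  moreover have "t * 1 \<le> 49 * (t * (1 + t))"
    using t by (simp add: algebra_simps)
  ultimately show ?thesis
    using Wt by simp
next
  case False
  define L where "L = ln (1 / t)"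
  have L: "0 < L" "log_plus (1 / t) = L"
    using False t by (auto simp: L_def log_plus_def ln_div)
  have "t = exp (- L)"
    using t by (simp add: L_def ln_div)
  then have sqrt_t: "sqrt t = exp (- L / 2)"
    by (simp add: real_sqrt_unique power2_eq_square exp_add[symmetric])
  \<comment> \<open>As \<open>9 \<le> exp 3\<close>, having \<open>m - 1 \<le> L / 12\<close> keeps
    \<open>9 ^ (m - 1)\<close> below \<open>exp (L / 4)\<close>. Rounding up ensures
    \<open>1 \<le> m\<close> at the cost of one factor 9.\<close>
  define m where "m = nat \<lceil>L / 12\<rceil>"
  have m: "1 \<le> m" "L \<le> 12 * real m" "real m \<le> L / 12 + 1"
    unfolding m_def using L(1) by linarith+
  have "(9::real) \<le> exp 3"
  proof -
    have "(3::real) \<le> exp (3 / 2)"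
      using exp_lower_Taylor_quadratic[of "3 / 2 :: real"] by (simp add: power2_eq_square)
    then have "3 * 3 \<le> exp (3 / 2) * exp (3 / 2 :: real)"
      by (intro mult_mono) auto
    then show ?thesis
      by (simp add: exp_add[symmetric])
  qed
  then have "(9::real) ^ (m - 1) \<le> exp 3 ^ (m - 1)"
    by (intro power_mono) auto
  also have "\<dots> = exp (3 * (real m - 1))"
    using m(1) by (simp add: exp_of_nat_mult[symmetric] of_nat_diff mult.commute)
  also have "\<dots> \<le> exp (L / 4)"
    using m(3) by simp
  finally have "9 ^ m \<le> 9 * exp (L / 4)"
    using m(1) by (cases m) auto
  then have "9 ^ m * (t * sqrt t) \<le> 9 * exp (L / 4) * (t * sqrt t)"
    using t by (intro mult_right_mono) auto
  also have "\<dots> = 9 * t * exp (- (L / 4))"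
    unfolding sqrt_t by (simp add: exp_add[symmetric] mult_ac) 
  finally have 1: "9 ^ m * (t * sqrt t) \<le> 9 * t * exp (- (L / 4))" .
  have "1 + L \<le> 4 * exp (L / 4)"
    using exp_ge_add_one_self[of "L / 4"] L(1) by linarith
  then have 2: "exp (- (L / 4)) \<le> 4 / (1 + L)"
    using L(1) by (simp add: exp_minus field_simps)
  \<comment> \<open>The 13 is 1 + 12, from \<open>1 \<le> m\<close> and
    \<open>L \<le> 12 * m\<close>.\<close>
  have "1 + L \<le> 13 * real m"
    using m(1,2) by simp
  then have 3: "1 / real m \<le> 13 / (1 + L)"
    using L(1) m(1) by (simp add: field_simps)
  have "W \<le> 9 * t * exp (- (L / 4)) + t * (1 / real m)"
    using Wm[OF m(1)] 1 by simp
  also have "\<dots> \<le> 9 * t * (4 / (1 + L)) + t * (13 / (1 + L))"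
    using t 2 3 by (intro add_mono mult_left_mono) auto
  \<comment> \<open>Here \<open>9 * 4 + 13 = 49\<close>.\<close>
  also have "\<dots> = 49 * (t / (1 + L))"
    by (simp add: divide_inverse algebra_simps)
  \<comment> \<open>The bound obtained is stronger than the goal: the power 1 of
    \<open>1 + L\<close> is lowered to \<open>1 / 2\<close>, and a factor \<open>1 + t\<close> is
    inserted.\<close>
  also have "\<dots> \<le> 49 * (t * (1 + t) / (1 + L) powr (1 / 2))"
  proof -
    have "(1 + L) powr (1 / 2) \<le> (1 + L) powr 1"
      using L(1) by (intro powr_mono) auto
    then have "(1 + L) powr (1 / 2) \<le> 1 + L"
      using L(1) by simp
    then show ?thesis
      using t L(1) by (intro mult_left_mono frac_le) (auto simp: algebra_simps)
  qed
  finally show ?thesis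
    using L(2) by simp
qed

section \<open>Pairings, trace and variance in Pauli coefficients\<close>

lemma hs_inner_cong:
  "(\<And>i j. i < N \<Longrightarrow> j < N \<Longrightarrow> X i j = X' i j) \<Longrightarrow> (\<And>i j. i < N \<Longrightarrow> j < N \<Longrightarrow> Y i j = Y' i j) \<Longrightarrow>
    hs_inner N X Y = hs_inner N X' Y'"
  unfolding hs_inner_def by (intro sum.cong) auto

lemma hs_inner_pauli_mat:
  "hs_inner (2 ^ n) (entries (pauli_mat n c)) (pauli_sum n d) = 2 ^ n * (\<Sum>S\<in>pauli_strings n. cnj (c S) * d S)"
  unfolding hs_inner_pauli_sum[symmetric] by (rule hs_inner_cong) (simp_all add: pauli_mat_def)

lemma hs_norm_pauli_mat:
  "(hs_norm (2 ^ n) (entries (pauli_mat n c)))\<^sup>2 = 2 ^ n * (\<Sum>S\<in>pauli_strings n. (cmod (c S))\<^sup>2)"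
proof -
  have "hs_norm (2 ^ n) (entries (pauli_mat n c)) = hs_norm (2 ^ n) (pauli_sum n c)"
    by (rule hs_norm_cong) (simp add: pauli_mat_def)
  then show ?thesis
    by (simp add: hs_norm_pauli_sum)
qed

text \<open>The trace is the inner product with the identity, which is the string of zeros, so
  Parseval picks out one coefficient.\<close>

lemma mat_trace_pauli_mat: "mat_trace (pauli_mat n c) = 2 ^ n * c (replicate n 0)"
proof -
  have 0: "replicate n 0 \<in> pauli_strings n"
    by (auto simp: pauli_strings_def)
  have "mat_trace (pauli_mat n c) = (\<Sum>i<2 ^ n. \<Sum>j<2 ^ n. if j = i then pauli_sum n c i j else 0)"
    by (simp add: mat_trace_def pauli_mat_def)
  also have "\<dots> = hs_inner (2 ^ n) (pauli_sum n (\<lambda>S. if S = replicate n 0 then 1 else 0)) (pauli_sum n c)"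
    unfolding hs_inner_def by (intro sum.cong refl) (auto simp: pauli_sum_scalar)
  also have "\<dots> = 2 ^ n * (\<Sum>S\<in>pauli_strings n. if S = replicate n 0 then c S else 0)"
    unfolding hs_inner_pauli_sum by (intro arg_cong2[where f = "(*)"] refl sum.cong) auto
  finally show ?thesis
    using 0 by simp
qed

text \<open>Subtracting the mean deletes the coefficient of the identity string; Parseval evaluates
  the rest, its \<open>2 ^ n\<close> cancelling the normalization.\<close>

lemma qvar_pauli_mat:
  "qvar n (pauli_mat n c) = (\<Sum>S\<in>pauli_strings n. if S = replicate n 0 then 0 else (cmod (c S))\<^sup>2)"
proof -
  let ?d = "\<lambda>S. c S - (if S = replicate n 0 then c (replicate n 0) else 0)"
  have eq: "pauli_mat n c - (mat_trace (pauli_mat n c) / 2 ^ n) \<cdot>\<^sub>m 1\<^sub>m (2 ^ n) = pauli_mat n ?d"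
    unfolding mat_trace_pauli_mat
    by (rule eq_matI) (simp_all add: pauli_mat_def pauli_sum_diff pauli_sum_scalar)
  have "qvar n (pauli_mat n c) = (root 2 ((\<Sum>S\<in>pauli_strings n. (cmod (?d S))\<^sup>2)))\<^sup>2"
    unfolding qvar_def eq schatten_norm_def
    by (simp add: trace_mat_abs_square[OF pauli_mat_carrier] hs_norm_pauli_mat)
  also have "\<dots> = (\<Sum>S\<in>pauli_strings n. (cmod (?d S))\<^sup>2)"
    by (rule real_root_pow_pos2) (simp_all add: sum_nonneg)
  also have "\<dots> = (\<Sum>S\<in>pauli_strings n. if S = replicate n 0 then 0 else (cmod (c S))\<^sup>2)"
    by (intro sum.cong) auto
  finally show ?thesis .
qed

lemma weight_eq_sum:
  assumes "S \<in> pauli_strings n"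
  shows "weight S = (\<Sum>j=1..n. if S ! (j - 1) = 0 then 0 else 1)"
proof -
  have n: "length S = n"
    using assms by (simp add: pauli_strings_def)
  have "weight S = card {i \<in> {..<n}. S ! i \<noteq> 0}"
    by (simp add: weight_def length_filter_conv_card n)
  also have "\<dots> = (\<Sum>i<n. if S ! i = 0 then 0 else 1)"
    unfolding card_eq_sum sum.inter_filter[OF finite_lessThan] by (intro sum.cong) auto
  finally show ?thesis
    by (simp add: sum.atLeast1_atMost_eq)
qed

lemma weight_eq_0_iff:
  assumes "S \<in> pauli_strings n"
  shows "weight S = 0 \<longleftrightarrow> S = replicate n 0"
proof -
  have "weight S = 0 \<longleftrightarrow> (\<forall>x\<in>set S. x = 0)"
    by (simp add: weight_def filter_empty_conv)
  also have "\<dots> \<longleftrightarrow> S = replicate (length S) 0"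
    by (metis in_set_replicate replicate_length_same)
  finally show ?thesis
    using assms by (simp add: pauli_strings_def)
qed

text \<open>By \<open>qdiff_pauli_mat\<close>, these are the coefficients of
  \<open>d\<^sub>j A\<close> when \<open>A\<close> has the coefficients \<open>c\<close>.\<close>

definition influence_coeffs :: "nat \<Rightarrow> (nat list \<Rightarrow> complex) \<Rightarrow> nat list \<Rightarrow> complex" where
  "influence_coeffs j c S = (if S ! (j - 1) = 0 then 0 else c S)"

text \<open>A string survives in \<open>d\<^sub>j A\<close> for exactly \<open>weight S\<close>
  values of \<open>j\<close>, so dividing by the weight makes it count once.\<close>

lemma qvar_eq_sum_influences:
  "qvar n (pauli_mat n c) = (\<Sum>j=1..n. \<Sum>S\<in>pauli_strings n. (cmod (influence_coeffs j c S))\<^sup>2 / weight S)"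
proof -
  have "(if S = replicate n 0 then 0 else (cmod (c S))\<^sup>2) = (\<Sum>j=1..n. (cmod (influence_coeffs j c S))\<^sup>2 / weight S)"
    if S: "S \<in> pauli_strings n" for S
  proof -
    have "(\<Sum>j=1..n. (cmod (influence_coeffs j c S))\<^sup>2 / weight S)
        = (\<Sum>j=1..n. (cmod (c S))\<^sup>2 / weight S * real (if S ! (j - 1) = 0 then 0 else 1))"
      by (intro sum.cong) (auto simp: influence_coeffs_def)
    also have "\<dots> = (cmod (c S))\<^sup>2 / weight S * real (weight S)"
      unfolding weight_eq_sum[OF S] of_nat_sum sum_distrib_left ..
    \<comment> \<open>For the identity string the convention \<open>x / 0 = 0\<close> makes both
      sides 0.\<close>
    finally show ?thesis
      using weight_eq_0_iff[OF S] by simp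
  qed
  then have "qvar n (pauli_mat n c) = (\<Sum>S\<in>pauli_strings n. \<Sum>j=1..n. (cmod (influence_coeffs j c S))\<^sup>2 / weight S)"
    unfolding qvar_pauli_mat by (intro sum.cong) auto
  also have "\<dots> = (\<Sum>j=1..n. \<Sum>S\<in>pauli_strings n. (cmod (influence_coeffs j c S))\<^sup>2 / weight S)"
    by (rule sum.swap)
  finally show ?thesis .
qed

lemma power_third_square: "(1 / 3) ^ w * (1 / 3) ^ w = (1 / 9 :: 'a::field_char_0) ^ w"
  unfolding power_mult_distrib[symmetric] by simp

text \<open>The left side \<open>u\<close> is
  \<open>\<parallel>T g\<parallel>\<^sub>2\<^sup>2\<close>, that is, the pairing of \<open>g\<close>
  with \<open>T (T g)\<close>. Hypercontractivity bounds the 4-norm of \<open>T (T g)\<close> by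
  \<open>\<parallel>T g\<parallel>\<^sub>2\<close>, and \<open>hs_inner_le_trace_norm\<close> then
  gives \<open>u\<^sup>2 \<le> \<parallel>g\<parallel>\<^sub>1 \<parallel>g\<parallel>\<^sub>2
  u\<close>, where one factor \<open>u\<close> cancels.\<close>

lemma noise_le_trace_norm:
  "(\<Sum>S\<in>pauli_strings n. (1 / 9) ^ weight S * (cmod (c S))\<^sup>2)
    \<le> trace_norm (pauli_mat n c) / 2 ^ n * sqrt (\<Sum>S\<in>pauli_strings n. (cmod (c S))\<^sup>2)"
proof -
  define t where "t = trace_norm (pauli_mat n c) / 2 ^ n"
  define s where "s = sqrt (\<Sum>S\<in>pauli_strings n. (cmod (c S))\<^sup>2)"
  define u where "u = (\<Sum>S\<in>pauli_strings n. (1 / 9) ^ weight S * (cmod (c S))\<^sup>2)"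
  have nn: "0 \<le> t" "0 \<le> s" "0 \<le> u"
    using trace_norm_nonneg[OF pauli_mat_carrier] by (simp_all add: t_def s_def u_def sum_nonneg)
  let ?d = "\<lambda>S. (1 / 3) ^ weight S * ((1 / 3) ^ weight S * c S)"
  have "cnj (c S) * ?d S = of_real ((1 / 9) ^ weight S * (cmod (c S))\<^sup>2)" for S
    unfolding of_real_mult complex_norm_square using power_third_square[where 'a = complex, of "weight S"]
    by (simp add: mult_ac)
  then have inner: "hs_inner (2 ^ n) (entries (pauli_mat n c)) (pauli_sum n ?d) = complex_of_real (2 ^ n * u)"
    unfolding hs_inner_pauli_mat u_def by simp
  have "hs_norm (2 ^ n) (gram (2 ^ n) (pauli_sum n ?d) (pauli_sum n ?d))
      \<le> sqrt (2 ^ n) * (\<Sum>S\<in>pauli_strings n. (cmod ((1 / 3) ^ weight S * c S))\<^sup>2)"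
    by (rule hypercontractivity)
  also have "(\<Sum>S\<in>pauli_strings n. (cmod ((1 / 3) ^ weight S * c S))\<^sup>2) = u"
    unfolding u_def using power_third_square[where 'a = real]
    by (intro sum.cong refl) (simp add: norm_mult norm_power power_mult_distrib power2_eq_square)
  finally have gram: "hs_norm (2 ^ n) (gram (2 ^ n) (pauli_sum n ?d) (pauli_sum n ?d)) \<le> sqrt (2 ^ n) * u" .
  have norm: "hs_norm (2 ^ n) (entries (pauli_mat n c)) = sqrt (2 ^ n) * s"
    unfolding s_def real_sqrt_mult[symmetric] hs_norm_pauli_mat[symmetric] by simp
  have "(2 ^ n * u)\<^sup>2 = (cmod (complex_of_real (2 ^ n * u)))\<^sup>2"
    by (simp only: norm_of_real power2_abs)
  also have "\<dots> \<le> (2 ^ n * t) * (sqrt (2 ^ n) * s * (sqrt (2 ^ n) * u))"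
    using hs_inner_le_trace_norm[OF pauli_mat_carrier, of n c "pauli_sum n ?d"] gram nn
    unfolding inner norm
    by (elim order.trans) (simp add: t_def mult_left_mono trace_norm_nonneg[OF pauli_mat_carrier])
  also have "\<dots> = (2 ^ n)\<^sup>2 * (t * s * u)"
    by (simp add: power2_eq_square algebra_simps)
  finally have "u\<^sup>2 \<le> t * s * u"
    by (simp add: power_mult_distrib)
  then have "u \<le> t * s"
    using nn by (cases "u = 0") (auto simp: power2_eq_square)
  then show ?thesis
    by (simp add: u_def t_def s_def)
qed

text \<open>Supplies the hypotheses of \<open>talagrand_scalar_bound\<close>:
  \<open>W \<le> t\<close> from pairing \<open>d\<^sub>j A\<close> with the contraction
  \<open>A\<close>, and the bounds for all \<open>m\<close> from splitting the strings at weight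
  \<open>m\<close>.\<close>

lemma influence_bound:
  assumes A: "op_norm (pauli_mat n c) \<le> 1" and j: "1 \<le> j" "j \<le> n"
  defines "t \<equiv> trace_norm (pauli_mat n (influence_coeffs j c)) / 2 ^ n"
  shows "(\<Sum>S\<in>pauli_strings n. (cmod (influence_coeffs j c S))\<^sup>2 / weight S)
    \<le> 49 * (if t = 0 then 0 else t * (1 + t) / (1 + log_plus (1 / t)) powr (1 / 2))"
proof -
  define d where "d = influence_coeffs j c"
  define E where "E = (\<Sum>S\<in>pauli_strings n. (cmod (d S))\<^sup>2)"
  define u where "u = (\<Sum>S\<in>pauli_strings n. (1 / 9) ^ weight S * (cmod (d S))\<^sup>2)"
  define W where "W = (\<Sum>S\<in>pauli_strings n. (cmod (d S))\<^sup>2 / weight S)"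
  have t: "0 \<le> t"
    unfolding t_def using trace_norm_nonneg[OF pauli_mat_carrier] by simp
  have E0: "0 \<le> E"
    unfolding E_def by (simp add: sum_nonneg)
  \<comment> \<open>Excludes the identity string, so that dividing by the weight never enlarges a
    term.\<close>
  have wt: "1 \<le> weight S" if "S \<in> pauli_strings n" "d S \<noteq> 0" for S
  proof -
    have "S ! (j - 1) \<noteq> 0"
      using that(2) by (auto simp: d_def influence_coeffs_def split: if_splits)
    then have "S \<noteq> replicate n 0"
      using j by auto
    then show ?thesis
      using weight_eq_0_iff[OF that(1)] by linarith
  qed
  \<comment> \<open>\<open>d\<close> arises from \<open>c\<close> by deleting coefficients, so
    pairing it with \<open>c\<close> is the same as pairing it with itself.\<close>
  have "hs_inner (2 ^ n) (entries (pauli_mat n d)) (entries (pauli_mat n c)) = complex_of_real (2 ^ n * E)"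
  proof -
    have term_eq: "cnj (d S) * c S = complex_of_real ((cmod (d S))\<^sup>2)" for S
      unfolding complex_norm_square by (simp add: d_def influence_coeffs_def)
    have "hs_inner (2 ^ n) (entries (pauli_mat n d)) (entries (pauli_mat n c))
        = hs_inner (2 ^ n) (entries (pauli_mat n d)) (pauli_sum n c)"
      by (rule hs_inner_cong) (simp_all add: pauli_mat_def)
    also have "\<dots> = 2 ^ n * (\<Sum>S\<in>pauli_strings n. complex_of_real ((cmod (d S))\<^sup>2))"
      unfolding hs_inner_pauli_mat term_eq ..
    finally show ?thesis
      by (simp add: E_def)
  qed
  then have "cmod (complex_of_real (2 ^ n * E)) \<le> trace_norm (pauli_mat n d)"
    using trace_norm_dual[OF pauli_mat_carrier[of n d] pauli_mat_carrier A] by simp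
  then have Et: "E \<le> t"
    using E0 unfolding norm_of_real t_def d_def by (simp add: field_simps)
  have WE: "W \<le> E"
    unfolding W_def E_def
  proof (rule sum_mono)
    fix S assume "S \<in> pauli_strings n"
    then show "(cmod (d S))\<^sup>2 / weight S \<le> (cmod (d S))\<^sup>2"
      using wt[of S] by (cases "d S = 0") (auto simp: divide_le_eq mult_le_cancel_left1)
  qed
  show ?thesis
  proof (cases "t = 0")
    case True
    \<comment> \<open>Then \<open>W \<le> E \<le> 0\<close>, in accordance with the convention that
      such a summand is 0.\<close>
    then show ?thesis
      using Et WE by (simp add: W_def d_def)
  next
    case False
    then have tpos: "0 < t"
      using t by simp
    have "u \<le> t * sqrt E"
      using noise_le_trace_norm[where n = n and c = d] by (simp add: u_def t_def E_def d_def)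
    also have "\<dots> \<le> t * sqrt t"
      using Et t by (intro mult_left_mono) auto
    finally have u: "u \<le> t * sqrt t" .
    have "W \<le> 9 ^ m * (t * sqrt t) + t / real m" if m: "1 \<le> m" for m
    proof -
      have "W \<le> (\<Sum>S\<in>pauli_strings n. 9 ^ m * ((1 / 9) ^ weight S * (cmod (d S))\<^sup>2) + (cmod (d S))\<^sup>2 / real m)"
        unfolding W_def
      proof (rule sum_mono)
        fix S assume S: "S \<in> pauli_strings n"
        show "(cmod (d S))\<^sup>2 / weight S \<le> 9 ^ m * ((1 / 9) ^ weight S * (cmod (d S))\<^sup>2) + (cmod (d S))\<^sup>2 / real m"
        proof (cases "d S = 0")
          case False
          then have w: "1 \<le> weight S"
            using wt S by blast
          \<comment> \<open>Weights up to \<open>m\<close> are absorbed by the noise term, since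
            there \<open>9 ^ m * (1 / 9) ^ weight S \<ge> 1\<close>; larger weights by
            \<open>1 / m\<close>.\<close>
          have "1 / real (weight S) \<le> 9 ^ m * (1 / 9) ^ weight S + 1 / real m"
          proof (cases "weight S \<le> m")
            case True
            have "1 / real (weight S) \<le> 1"
              using w by simp
            also have "1 \<le> 9 ^ (m - weight S) * ((9::real) ^ weight S * (1 / 9) ^ weight S)"
              unfolding power_mult_distrib[symmetric] by simp
            also have "\<dots> = 9 ^ m * (1 / 9) ^ weight S"
              using True by (simp add: power_add[symmetric] mult.assoc[symmetric] del: power_one_over)
            finally show ?thesis
              by (simp add: add_increasing2)
          next
            case False
            then have "1 / real (weight S) \<le> 1 / real m"
              using m by (intro divide_left_mono) auto
            then show ?thesis
              by (simp add: add_increasing)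
          qed
          then have "(cmod (d S))\<^sup>2 * (1 / real (weight S)) \<le> (cmod (d S))\<^sup>2 * (9 ^ m * (1 / 9) ^ weight S + 1 / real m)"
            by (rule mult_left_mono) simp
          then show ?thesis
            by (simp add: algebra_simps)
        qed simp
      qed
      also have "\<dots> = 9 ^ m * u + E / real m"
        unfolding u_def E_def sum.distrib sum_distrib_left sum_divide_distrib ..
      also have "\<dots> \<le> 9 ^ m * (t * sqrt t) + t / real m"
        using u Et by (intro add_mono mult_left_mono divide_right_mono) auto
      finally show ?thesis .
    qed
    then show ?thesis
      using talagrand_scalar_bound[OF tpos, of W] WE Et False by (simp add: W_def d_def)
  qed
qed

theorem theorem3p2:
  shows "\<exists>C>0. \<forall>n\<ge>1. \<forall>A\<in>carrier_mat (2 ^ n) (2 ^ n). op_norm A \<le> 1 \<longrightarrow>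
    qvar n A \<le> C * (\<Sum>j=1..n.
      let t = schatten_norm n 1 (qdiff n j A)
      in if t = 0 then 0 else t * (1 + t) / (1 + log_plus (1 / t)) powr (1 / 2))"
proof (intro exI[of _ 49] conjI allI impI ballI)
  fix n :: nat and A :: "complex mat"
  assume "A \<in> carrier_mat (2 ^ n) (2 ^ n)" and op: "op_norm A \<le> 1"
  obtain c where "\<forall>i<2 ^ n. \<forall>j<2 ^ n. pauli_sum n c i j = A $$ (i, j)"
    using pauli_sum_surj[of n "entries A"] by auto
  then have A: "A = pauli_mat n c"
    using \<open>A \<in> carrier_mat (2 ^ n) (2 ^ n)\<close> by (intro eq_matI) (auto simp: pauli_mat_def)
  have t: "schatten_norm n 1 (qdiff n j A) = trace_norm (pauli_mat n (influence_coeffs j c)) / 2 ^ n"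
    if "j \<in> {1..n}" for j
  proof -
    have "qdiff n j A = pauli_mat n (influence_coeffs j c)"
      unfolding A using qdiff_pauli_mat[of j n c] that by (simp add: influence_coeffs_def[abs_def])
    moreover have "mat_abs B ^\<^sub>m 1 = mat_abs B" for B
      by simp
    ultimately show ?thesis
      by (simp add: schatten_norm_def trace_norm_def)
  qed
  \<comment> \<open>The comparison is made for each \<open>j\<close> separately, so the constant of
    \<open>influence_bound\<close> serves every \<open>n\<close>.\<close>
  show "qvar n A \<le> 49 * (\<Sum>j=1..n.
      let t = schatten_norm n 1 (qdiff n j A)
      in if t = 0 then 0 else t * (1 + t) / (1 + log_plus (1 / t)) powr (1 / 2))"
    unfolding A qvar_eq_sum_influences sum_distrib_left
  proof (rule sum_mono)
    fix j assume j: "j \<in> {1..n}"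
    show "(\<Sum>S\<in>pauli_strings n. (cmod (influence_coeffs j c S))\<^sup>2 / weight S)
      \<le> 49 * (let t = schatten_norm n 1 (qdiff n j (pauli_mat n c))
          in if t = 0 then 0 else t * (1 + t) / (1 + log_plus (1 / t)) powr (1 / 2))"
      unfolding Let_def t[OF j, unfolded A]
      by (rule influence_bound) (use op j in \<open>simp_all add: A\<close>)
  qed
qed simp

end
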